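(* Let $G=(V,E)$ be a finite connected graph with girth at least $6$, with edges $E=\{e_1,\dots,e_n\}$. Assume that the prescribed curvature $\kappa^*\in\mathbb{R}^n$ is attainable, i.e. there exists $\bm\omega^*\in\mathbb{R}^n_{>0}$ with $\kappa_i(\bm\omega^* )=\kappa_i^*$ for all $i$. Then for every $\bm\omega_0\in\mathbb{R}^n_{>0}$ the solution $\bm\omega(t)$ of $$\frac{d}{dt}\omega_i=-(\kappa_i(\bm\omega)-\kappa_i^* )\,\omega_i,\quad i=1,\dots,n,\qquad \bm\omega(0)=\bm\omega_0,$$ converges exponentially as $t\to\infty$ to $c\,\bm\omega^*$ for some constant $c>0$, and the Lin-Lu-Yau curvature $(\kappa_1(\bm\omega(t)),\dots,\kappa_n(\bm\omega(t)))$ converges exponentially to $\kappa^*$.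
   Context: Graphs are finite, connected, undirected and simple. The girth is the length of a shortest cycle; girth at least $6$ means there are no cycles of length $3$, $4$ or $5$ (trees are included). A weight is a vector $\bm\omega=(\omega_1,\dots,\omega_n)\in\mathbb{R}^n_{>0}$ with $\omega_i=\omega(e_i)$; $\omega_{xy}=\omega_{yx}$ is the weight of edge $(x,y)$. Write $y\sim x$ if $(x,y)\in E$, and $m(x)=\sum_{y\sim x}\omega_{xy}$. The distance $d(u,v)$ is the combinatorial one (number of edges of a shortest path) and does not depend on the weights or on time. Lin-Lu-Yau curvature: for $x\in V$ and $\alpha\in(0,1)$ let $m_x^\alpha$ be the probability measure with $m_x^\alpha(x)=\alpha$, $m_x^\alpha(y)=(1-\alpha)\omega_{xy}/m(x)$ for $y\sim x$, and $0$ otherwise. For an edge $e_i=(x,y)$, $\kappa_i(\bm\omega)=\lim_{\alpha\to1^-}\frac{1}{1-\alpha}\left(1-W(m_x^\alpha,m_y^\alpha)\right)$, where $W$ is the $1$-Wasserstein distance with respect to $d$. On a graph with girth at least $6$ one has, for every edge $e=(x,y)$, $\kappa_e=2\omega_e\left(\frac1{m(x)}+\frac1{m(y)}\right)-2$. A function $\bm u(t)$ converges exponentially to $\bm u_\infty$ if there are $C,\lambda>0$ with $\|\bm u(t)-\bm u_\infty\|\le Ce^{-\lambda t}$ for all $t\ge0$. *)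

theory Defs
  imports "HOL-Analysis.Analysis" "HOL-Library.Extended_Nat"
begin

text \<open>
  A graph is given by its vertex set \<open>V\<close> and its set \<open>E\<close> of edges, an edge being the
  two-element set of its endpoints. Vectors in \<open>\<real>\<^sup>n\<close> indexed by the edges
  \<open>e\<^sub>1, \<dots>, e\<^sub>n\<close> are functions \<open>'a set \<Rightarrow> real\<close>, of which only the values on \<open>E\<close>
  matter. This includes the one-vertex graph (\<open>n = 0\<close>).
\<close>

definition simple_graph :: "'a set \<Rightarrow> 'a set set \<Rightarrow> bool" where
  "simple_graph V E \<longleftrightarrow>
     finite V \<and> V \<noteq> {} \<and> E \<subseteq> {{u, v} | u v. u \<in> V \<and> v \<in> V \<and> u \<noteq> v}"

definition graph_path :: "'a set \<Rightarrow> 'a set set \<Rightarrow> 'a \<Rightarrow> 'a \<Rightarrow> 'a list \<Rightarrow> bool" where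
  "graph_path V E u v p \<longleftrightarrow>
     p \<noteq> [] \<and> hd p = u \<and> last p = v \<and> distinct p \<and> set p \<subseteq> V \<and>
     successively (\<lambda>a b. {a, b} \<in> E) p"

definition connected_graph :: "'a set \<Rightarrow> 'a set set \<Rightarrow> bool" where
  "connected_graph V E \<longleftrightarrow>
     simple_graph V E \<and> (\<forall>u\<in>V. \<forall>v\<in>V. \<exists>p. graph_path V E u v p)"

definition graph_dist :: "'a set \<Rightarrow> 'a set set \<Rightarrow> 'a \<Rightarrow> 'a \<Rightarrow> nat" where
  "graph_dist V E u v = (LEAST k. \<exists>p. graph_path V E u v p \<and> length p = Suc k)"

definition graph_cycle :: "'a set \<Rightarrow> 'a set set \<Rightarrow> 'a list \<Rightarrow> bool" where
  "graph_cycle V E c \<longleftrightarrow>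
     3 \<le> length c \<and> distinct c \<and> set c \<subseteq> V \<and>
     successively (\<lambda>a b. {a, b} \<in> E) c \<and> {last c, hd c} \<in> E"

text \<open>The girth of a tree is \<open>\<infinity>\<close>, the infimum of the empty set.\<close>

definition girth :: "'a set \<Rightarrow> 'a set set \<Rightarrow> enat" where
  "girth V E = Inf {enat (length c) | c. graph_cycle V E c}"

definition positive_weight :: "'a set set \<Rightarrow> ('a set \<Rightarrow> real) \<Rightarrow> bool" where
  "positive_weight E \<omega> \<longleftrightarrow> (\<forall>e\<in>E. 0 < \<omega> e)"

definition vertex_weight :: "'a set set \<Rightarrow> ('a set \<Rightarrow> real) \<Rightarrow> 'a \<Rightarrow> real" where
  "vertex_weight E \<omega> x = (\<Sum>y | {x, y} \<in> E. \<omega> {x, y})"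

definition lazy_measure ::
  "'a set set \<Rightarrow> ('a set \<Rightarrow> real) \<Rightarrow> real \<Rightarrow> 'a \<Rightarrow> 'a \<Rightarrow> real" where
  "lazy_measure E \<omega> \<alpha> x z =
     (if z = x then \<alpha>
      else if {x, z} \<in> E then (1 - \<alpha>) * \<omega> {x, z} / vertex_weight E \<omega> x
      else 0)"

definition coupling ::
  "'a set \<Rightarrow> ('a \<Rightarrow> real) \<Rightarrow> ('a \<Rightarrow> real) \<Rightarrow> ('a \<Rightarrow> 'a \<Rightarrow> real) \<Rightarrow> bool" where
  "coupling V \<mu> \<nu> \<pi> \<longleftrightarrow>
     (\<forall>u\<in>V. \<forall>v\<in>V. 0 \<le> \<pi> u v) \<and>
     (\<forall>u\<in>V. (\<Sum>v\<in>V. \<pi> u v) = \<mu> u) \<and>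
     (\<forall>v\<in>V. (\<Sum>u\<in>V. \<pi> u v) = \<nu> v)"

definition wasserstein ::
  "'a set \<Rightarrow> 'a set set \<Rightarrow> ('a \<Rightarrow> real) \<Rightarrow> ('a \<Rightarrow> real) \<Rightarrow> real" where
  "wasserstein V E \<mu> \<nu> =
     Inf {\<Sum>u\<in>V. \<Sum>v\<in>V. \<pi> u v * real (graph_dist V E u v) | \<pi>. coupling V \<mu> \<nu> \<pi>}"

definition lly_curvature_pair ::
  "'a set \<Rightarrow> 'a set set \<Rightarrow> ('a set \<Rightarrow> real) \<Rightarrow> 'a \<Rightarrow> 'a \<Rightarrow> real" where
  "lly_curvature_pair V E \<omega> x y =
     Lim (at_left 1)
       (\<lambda>\<alpha>. 1 / (1 - \<alpha>) *
          (1 - wasserstein V E (lazy_measure E \<omega> \<alpha> x) (lazy_measure E \<omega> \<alpha> y)))"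

text \<open>
  The curvature of an edge does not depend on the order of its endpoints, as the
  lemma \<open>lly_curvature_edge\<close> below confirms.
\<close>

definition lly_curvature ::
  "'a set \<Rightarrow> 'a set set \<Rightarrow> ('a set \<Rightarrow> real) \<Rightarrow> 'a set \<Rightarrow> real" where
  "lly_curvature V E \<omega> e =
     (THE k. \<exists>x y. e = {x, y} \<and> k = lly_curvature_pair V E \<omega> x y)"

lemma graph_path_rev:
  assumes "graph_path V E u v p"
  shows "graph_path V E v u (rev p)"
  using assms unfolding graph_path_def
  by (auto simp: hd_rev last_rev insert_commute)

lemma graph_dist_commute: "graph_dist V E u v = graph_dist V E v u"
proof -
  have "(\<exists>p. graph_path V E u v p \<and> length p = Suc k) \<longleftrightarrow>
        (\<exists>p. graph_path V E v u p \<and> length p = Suc k)" for k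
    by (metis graph_path_rev length_rev)
  then show ?thesis
    unfolding graph_dist_def by simp
qed

lemma wasserstein_commute: "wasserstein V E \<mu> \<nu> = wasserstein V E \<nu> \<mu>"
proof -
  let ?S = "\<lambda>\<mu> \<nu>. {\<Sum>u\<in>V. \<Sum>v\<in>V. \<pi> u v * real (graph_dist V E u v) | \<pi>. coupling V \<mu> \<nu> \<pi>}"
  have sub: "?S \<mu> \<nu> \<subseteq> ?S \<nu> \<mu>" for \<mu> \<nu>
  proof
    fix s assume "s \<in> ?S \<mu> \<nu>"
    then obtain \<pi> where \<pi>: "coupling V \<mu> \<nu> \<pi>"
      and s: "s = (\<Sum>u\<in>V. \<Sum>v\<in>V. \<pi> u v * real (graph_dist V E u v))"
      by blast
    have "coupling V \<nu> \<mu> (\<lambda>u v. \<pi> v u)"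
      using \<pi> by (auto simp: coupling_def)
    moreover have "s = (\<Sum>u\<in>V. \<Sum>v\<in>V. \<pi> v u * real (graph_dist V E u v))"
      unfolding s by (subst sum.swap) (simp add: graph_dist_commute)
    ultimately show "s \<in> ?S \<nu> \<mu>"
      by (intro CollectI exI[of _ "\<lambda>u v. \<pi> v u"]) simp
  qed
  have "?S \<mu> \<nu> = ?S \<nu> \<mu>"
    by (intro subset_antisym sub)
  then show ?thesis
    unfolding wasserstein_def by simp
qed

lemma lly_curvature_edge: "lly_curvature V E \<omega> {x, y} = lly_curvature_pair V E \<omega> x y"
proof -
  have "lly_curvature_pair V E \<omega> x y = lly_curvature_pair V E \<omega> y x"
    unfolding lly_curvature_pair_def by (subst wasserstein_commute) (rule refl)
  then show ?thesis
    unfolding lly_curvature_def by (intro the_equality) (auto simp: doubleton_eq_iff)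
qed

definition ricci_flow ::
  "'a set \<Rightarrow> 'a set set \<Rightarrow> ('a set \<Rightarrow> real) \<Rightarrow> ('a set \<Rightarrow> real) \<Rightarrow> (real \<Rightarrow> 'a set \<Rightarrow> real) \<Rightarrow> bool"
  where
  "ricci_flow V E \<kappa>' \<omega>\<^sub>0 \<omega> \<longleftrightarrow>
     (\<forall>e\<in>E. \<omega> 0 e = \<omega>\<^sub>0 e) \<and>
     (\<forall>t\<ge>0. positive_weight E (\<omega> t)) \<and>
     (\<forall>t\<ge>0. \<forall>e\<in>E.
        ((\<lambda>s. \<omega> s e) has_real_derivative
           - (lly_curvature V E (\<omega> t) e - \<kappa>' e) * \<omega> t e) (at t within {0..}))"

text \<open>\<^const>\<open>L2_set\<close> is the Euclidean norm of a vector indexed by a finite set.\<close>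

definition converges_exponentially ::
  "'i set \<Rightarrow> (real \<Rightarrow> 'i \<Rightarrow> real) \<Rightarrow> ('i \<Rightarrow> real) \<Rightarrow> bool" where
  "converges_exponentially I u u' \<longleftrightarrow>
     (\<exists>C>0. \<exists>l>0. \<forall>t\<ge>0. L2_set (\<lambda>i. u t i - u' i) I \<le> C * exp (- l * t))"

end

theory Submission
  imports Defs
begin

text \<open>
  On a graph of girth at least 6 the neighbourhood of an edge is a tree as far as
  transport between the lazy measures at its endpoints is concerned. An explicit transport
  plan and an explicit potential certify each other's optimality, and
  \<open>lly_curvature_girth_ge_6\<close> gives
  \<open>\<kappa>\<^sub>e = 2 * (\<Sum>x\<in>e. \<omega>\<^sub>e / m(x)) - 2\<close>.

  In the coordinates \<open>r = ln \<omega>\<close> the quotient \<open>\<omega>\<^sub>e / m(x)\<close> is the partial derivative of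
  \<open>ln (m(x))\<close>, a log-sum-exp function of \<open>r\<close>. The flow \<open>r' = \<kappa>' - \<kappa>\<close> is therefore the
  negative gradient flow of the convex function
  \<open>2 * (\<Sum>x. ln (m(x))) - (\<Sum>e. (2 + \<kappa>' e) * r e)\<close>, of which \<open>ln \<omega>'\<close> is a critical point.
  The gradient is globally Lipschitz, so solutions exist for all times
  (\<open>picard_lindelof_global\<close>), and distances between solutions do not increase
  (\<open>log_flow_contracts\<close>), which gives uniqueness.

  The function is not strictly convex: scaling \<open>\<omega>\<close> translates \<open>r\<close> along \<open>(1, \<dots>, 1)\<close> and
  does not change the curvature. But the total curvature does not depend on the weights,
  so the sum of all \<open>r e\<close> is conserved, and this fixes the constant \<open>c\<close> in the limit
  \<open>c * \<omega>'\<close>. On the hyperplanes where the sum is fixed, connectedness of the graph gives strong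
  convexity on bounded sets (\<open>log_curvature_strongly_monotone\<close>, by a Poincare inequality
  along paths). As the solution stays in a ball around the critical point, its distance to
  that point decays exponentially. Finally \<open>exp\<close> is Lipschitz on bounded sets and the
  curvature is Lipschitz in \<open>r\<close>, so the rate carries over to the weights and to
  the curvature.
\<close>

section \<open>Curvature of graphs of girth at least 6\<close>

definition edges_at :: "'a set set \<Rightarrow> 'a \<Rightarrow> 'a set set" where
  "edges_at E x = {e \<in> E. x \<in> e}"

lemma simple_graph_edge:
  assumes "simple_graph V E" "{x, y} \<in> E"
  shows "x \<in> V" "y \<in> V" "x \<noteq> y"
  using assms by (auto simp: simple_graph_def doubleton_eq_iff)

lemma simple_graph_edgeE:
  assumes "simple_graph V E" "e \<in> E"
  obtains x y where "e = {x, y}" "x \<noteq> y" "x \<in> V" "y \<in> V"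
  using assms by (auto simp: simple_graph_def dest!: subsetD)

lemma simple_graph_finite:
  assumes "simple_graph V E"
  shows "finite V" "finite E"
proof -
  show "finite V" using assms by (simp add: simple_graph_def)
  moreover have "E \<subseteq> Pow V" using assms by (auto elim: simple_graph_edgeE)
  ultimately show "finite E" by (meson finite_Pow_iff finite_subset)
qed

lemma vertex_weight_eq_sum_edges_at:
  assumes "simple_graph V E"
  shows "vertex_weight E \<omega> x = (\<Sum>e\<in>edges_at E x. \<omega> e)"
proof -
  have "edges_at E x = (\<lambda>y. {x, y}) ` {y. {x, y} \<in> E}"
  proof (intro subset_antisym subsetI)
    fix e assume "e \<in> edges_at E x"
    then have e: "e \<in> E" "x \<in> e" by (auto simp: edges_at_def)
    obtain a b where ab: "e = {a, b}" using simple_graph_edgeE[OF assms e(1)] .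
    with e have "e = {x, a} \<or> e = {x, b}" by auto
    with e show "e \<in> (\<lambda>y. {x, y}) ` {y. {x, y} \<in> E}" by blast
  qed (auto simp: edges_at_def)
  moreover have "inj_on (\<lambda>y. {x, y}) {y. {x, y} \<in> E}"
    by (auto simp: inj_on_def doubleton_eq_iff)
  ultimately show ?thesis
    by (simp add: vertex_weight_def sum.reindex)
qed

lemma vertex_weight_pos:
  assumes "simple_graph V E" "positive_weight E \<omega>" "{x, y} \<in> E"
  shows "0 < vertex_weight E \<omega> x"
  unfolding vertex_weight_eq_sum_edges_at[OF assms(1)]
  using assms simple_graph_finite[OF assms(1)]
  by (intro sum_pos) (auto simp: edges_at_def positive_weight_def)

lemma graph_dist_le_path_length:
  assumes "graph_path V E u v p"
  shows "graph_dist V E u v \<le> length p - 1"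
  unfolding graph_dist_def
proof (rule Least_le)
  show "\<exists>q. graph_path V E u v q \<and> length q = Suc (length p - 1)"
    using assms by (intro exI[of _ p]) (simp add: graph_path_def)
qed

lemma graph_dist_attained:
  assumes "connected_graph V E" "u \<in> V" "v \<in> V"
  obtains p where "graph_path V E u v p" "length p = Suc (graph_dist V E u v)"
proof -
  obtain p where p: "graph_path V E u v p"
    using assms by (auto simp: connected_graph_def)
  then have "length p = Suc (length p - 1)" by (simp add: graph_path_def)
  with p have "\<exists>q. graph_path V E u v q \<and> length q = Suc (length p - 1)" by blast
  from LeastI[of "\<lambda>k. \<exists>q. graph_path V E u v q \<and> length q = Suc k", OF this]
  show ?thesis using that unfolding graph_dist_def by blast
qed

text \<open>
  Only distances up to 3 occur between the supports of the two lazy measures, so it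
  suffices to know what a distance smaller than 3 means in terms of edges.
\<close>

lemma graph_dist_cases:
  assumes "connected_graph V E" "u \<in> V" "v \<in> V"
  shows "u = v \<or> {u, v} \<in> E \<and> 1 \<le> graph_dist V E u v
       \<or> (\<exists>w. {u, w} \<in> E \<and> {w, v} \<in> E) \<and> 2 \<le> graph_dist V E u v
       \<or> 3 \<le> graph_dist V E u v"
proof -
  obtain p where p: "graph_path V E u v p" "length p = Suc (graph_dist V E u v)"
    using graph_dist_attained[OF assms] .
  consider "length p = 1" | "length p = 2" | "length p = 3" | "4 \<le> length p"
    using p(2) by linarith
  then show ?thesis
  proof cases
    case 1
    then obtain a where "p = [a]" by (auto simp: length_Suc_conv)
    then show ?thesis using p by (auto simp: graph_path_def)
  next
    case 2
    then obtain a b where "p = [a, b]" by (auto simp: length_Suc_conv numeral_eq_Suc)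
    then show ?thesis using p by (auto simp: graph_path_def)
  next
    case 3
    then obtain a b c where "p = [a, b, c]" by (auto simp: length_Suc_conv numeral_eq_Suc)
    then show ?thesis using p by (auto simp: graph_path_def)
  next
    case 4
    then show ?thesis using p by auto
  qed
qed

lemma cycle_length_ge_girth:
  assumes "6 \<le> girth V E" "graph_cycle V E c"
  shows "6 \<le> length c"
proof -
  have "girth V E \<le> enat (length c)"
    using assms(2) unfolding girth_def by (intro Inf_lower) blast
  with assms(1) have "6 \<le> enat (length c)" by (rule order_trans)
  then show ?thesis by (metis enat_ord_simps(1) numeral_eq_enat)
qed

lemma no_triangle:
  assumes "simple_graph V E" "6 \<le> girth V E" "{a, b} \<in> E" "{b, c} \<in> E" "{c, a} \<in> E"
  shows False
proof -
  have "graph_cycle V E [a, b, c]"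
    using assms(3-) simple_graph_edge[OF assms(1,3)] simple_graph_edge[OF assms(1,4)]
      simple_graph_edge[OF assms(1,5)]
    by (simp add: graph_cycle_def)
  from cycle_length_ge_girth[OF assms(2) this] show False by simp
qed

lemma no_square:
  assumes "simple_graph V E" "6 \<le> girth V E"
    and "{a, b} \<in> E" "{b, c} \<in> E" "{c, d} \<in> E" "{d, a} \<in> E" "a \<noteq> c" "b \<noteq> d"
  shows False
proof -
  have "graph_cycle V E [a, b, c, d]"
    using assms(3-) simple_graph_edge[OF assms(1,3)] simple_graph_edge[OF assms(1,4)]
      simple_graph_edge[OF assms(1,5)] simple_graph_edge[OF assms(1,6)]
    by (simp add: graph_cycle_def)
  from cycle_length_ge_girth[OF assms(2) this] show False by simp
qed

lemma no_pentagon: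
  assumes "simple_graph V E" "6 \<le> girth V E"
    and "{a, b} \<in> E" "{b, c} \<in> E" "{c, d} \<in> E" "{d, e} \<in> E" "{e, a} \<in> E"
    and "distinct [a, b, c, d, e]"
  shows False
proof -
  have "graph_cycle V E [a, b, c, d, e]"
    using assms(3-) simple_graph_edge[OF assms(1,3)] simple_graph_edge[OF assms(1,4)]
      simple_graph_edge[OF assms(1,5)] simple_graph_edge[OF assms(1,6)]
      simple_graph_edge[OF assms(1,7)]
    by (simp add: graph_cycle_def)
  from cycle_length_ge_girth[OF assms(2) this] show False by simp
qed

text \<open>
  A path of length less than 3 from a neighbour of \<open>x\<close> to a neighbour of \<open>y\<close> would
  close up with the edge \<open>{x, y}\<close> to a cycle of length 3, 4 or 5. This is the only
  place where pentagons are excluded.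
\<close>

lemma dist_neighbours_of_edge:
  assumes "connected_graph V E" "6 \<le> girth V E" "{x, y} \<in> E"
    and "{x, u} \<in> E" "u \<noteq> y" "{y, v} \<in> E" "v \<noteq> x"
  shows "3 \<le> graph_dist V E u v"
proof (rule ccontr)
  have G: "simple_graph V E" using assms(1) by (simp add: connected_graph_def)
  note edge = simple_graph_edge[OF G]
  assume "\<not> 3 \<le> graph_dist V E u v"
  then consider "u = v" | "{u, v} \<in> E" "u \<noteq> v"
    | w where "{u, w} \<in> E" "{w, v} \<in> E" "u \<noteq> v"
    using graph_dist_cases[OF assms(1) edge(2)[OF assms(4)] edge(2)[OF assms(6)]] by blast
  then show False
  proof cases
    case 1
    then show False
      using no_triangle[OF G assms(2,3,6)] assms(4) by (simp add: insert_commute)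
  next
    case 2
    then show False
      using no_square[OF G assms(2) _ assms(3,6), of u] assms(4,5,7) by (simp add: insert_commute)
  next
    case 3
    have "w \<noteq> x"
      using 3(2) no_triangle[OF G assms(2,3,6)] by (auto simp: insert_commute)
    moreover have "w \<noteq> y"
      using 3(1) no_triangle[OF G assms(2,3), of u] assms(4) by (auto simp: insert_commute)
    ultimately have "distinct [u, x, y, v, w]"
      using 3(3) assms(5,7) edge(3)[OF 3(1)] edge(3)[OF 3(2)] edge(3)[OF assms(3)]
        edge(3)[OF assms(4)] edge(3)[OF assms(6)] by auto
    then show False
      using no_pentagon[OF G assms(2) _ assms(3,6), of u w] 3 assms(4)
      by (simp add: insert_commute)
  qed
qed

lemma dist_neighbour_across_edge:
  assumes "connected_graph V E" "6 \<le> girth V E" "{x, y} \<in> E" "{x, u} \<in> E" "u \<noteq> y"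
  shows "2 \<le> graph_dist V E u y"
proof -
  have G: "simple_graph V E" using assms(1) by (simp add: connected_graph_def)
  have "{u, y} \<notin> E"
    using no_triangle[OF G assms(2,3), of u] assms(4) by (auto simp: insert_commute)
  then show ?thesis
    using graph_dist_cases[OF assms(1) simple_graph_edge(2)[OF G assms(4)]
        simple_graph_edge(2)[OF G assms(3)]] assms(5)
    by auto
qed

text \<open>
  Weak Kantorovich duality with complementary slackness: a potential that is
  1-Lipschitz between the supports bounds the cost of every coupling from below, and a
  coupling concentrated on pairs where the potential drops by the full distance attains
  this bound. Requiring the Lipschitz condition only between the supports makes it
  unnecessary to extend the potential to the whole graph.
\<close>

lemma wasserstein_eq_dual:
  assumes "finite V" and \<pi>: "coupling V \<mu> \<nu> \<pi>"
    and lip: "\<And>u v. u \<in> V \<Longrightarrow> v \<in> V \<Longrightarrow> \<mu> u \<noteq> 0 \<Longrightarrow> \<nu> v \<noteq> 0 \<Longrightarrow>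
                f u - f v \<le> real (graph_dist V E u v)"
    and tight: "\<And>u v. u \<in> V \<Longrightarrow> v \<in> V \<Longrightarrow> \<pi> u v \<noteq> 0 \<Longrightarrow>
                real (graph_dist V E u v) \<le> f u - f v"
  shows "wasserstein V E \<mu> \<nu> = (\<Sum>u\<in>V. f u * \<mu> u) - (\<Sum>v\<in>V. f v * \<nu> v)"
proof -
  let ?cost = "\<lambda>\<rho>. \<Sum>u\<in>V. \<Sum>v\<in>V. \<rho> u v * real (graph_dist V E u v)"
  let ?dual = "(\<Sum>u\<in>V. f u * \<mu> u) - (\<Sum>v\<in>V. f v * \<nu> v)"
  have dual: "(\<Sum>u\<in>V. \<Sum>v\<in>V. \<rho> u v * (f u - f v)) = ?dual" if "coupling V \<mu> \<nu> \<rho>" for \<rho>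
  proof -
    have "(\<Sum>u\<in>V. \<Sum>v\<in>V. \<rho> u v * (f u - f v))
        = (\<Sum>u\<in>V. \<Sum>v\<in>V. f u * \<rho> u v) - (\<Sum>u\<in>V. \<Sum>v\<in>V. f v * \<rho> u v)"
      by (simp add: algebra_simps sum_subtractf)
    also have "(\<Sum>u\<in>V. \<Sum>v\<in>V. f u * \<rho> u v) = (\<Sum>u\<in>V. f u * \<mu> u)"
      using that by (simp add: coupling_def flip: sum_distrib_left)
    also have "(\<Sum>u\<in>V. \<Sum>v\<in>V. f v * \<rho> u v) = (\<Sum>v\<in>V. f v * \<nu> v)"
      using that by (subst sum.swap) (simp add: coupling_def flip: sum_distrib_left)
    finally show ?thesis .
  qed
  have ge: "?dual \<le> ?cost \<rho>" if \<rho>: "coupling V \<mu> \<nu> \<rho>" for \<rho>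
  proof -
    have "\<rho> u v * (f u - f v) \<le> \<rho> u v * real (graph_dist V E u v)"
      if uv: "u \<in> V" "v \<in> V" for u v
    proof (cases "\<rho> u v = 0")
      case False
      have nn: "0 \<le> \<rho> u' v'" if "u' \<in> V" "v' \<in> V" for u' v'
        using \<rho> that by (simp add: coupling_def)
      have pos: "0 < \<rho> u v" using False nn[OF uv] by linarith
      have "\<rho> u v \<le> \<mu> u" "\<rho> u v \<le> \<nu> v"
        using \<rho> uv nn member_le_sum[of v V "\<rho> u"] member_le_sum[of u V "\<lambda>u. \<rho> u v"] \<open>finite V\<close>
        by (simp_all add: coupling_def)
      with pos lip[OF uv] nn[OF uv] show ?thesis by (intro mult_left_mono) auto
    qed simp
    then show ?thesis
      unfolding dual[OF \<rho>, symmetric] by (intro sum_mono) auto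
  qed
  have "?cost \<pi> \<le> ?dual"
  proof -
    have "\<pi> u v * real (graph_dist V E u v) \<le> \<pi> u v * (f u - f v)"
      if uv: "u \<in> V" "v \<in> V" for u v
      using tight[OF uv] \<pi> uv by (cases "\<pi> u v = 0") (auto simp: coupling_def intro!: mult_left_mono)
    then show ?thesis
      unfolding dual[OF \<pi>, symmetric] by (intro sum_mono) auto
  qed
  with ge[OF \<pi>] have "?dual = ?cost \<pi>" by linarith
  then show ?thesis
    unfolding wasserstein_def using \<pi> ge by (intro cInf_eq_minimum) auto
qed

lemma lazy_measure_self: "lazy_measure E \<omega> \<alpha> x x = \<alpha>"
  by (simp add: lazy_measure_def)

lemma lazy_measure_nonneg:
  assumes "simple_graph V E" "positive_weight E \<omega>" "0 \<le> \<alpha>" "\<alpha> \<le> 1"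
  shows "0 \<le> lazy_measure E \<omega> \<alpha> x z"
  using assms vertex_weight_pos[OF assms(1,2), of x z]
  by (auto simp: lazy_measure_def positive_weight_def intro!: divide_nonneg_nonneg mult_nonneg_nonneg
      intro: less_imp_le)

lemma sum_lazy_measure_off_centre:
  assumes "simple_graph V E" "positive_weight E \<omega>" "{x, y} \<in> E"
  shows "(\<Sum>z\<in>V - {x}. lazy_measure E \<omega> \<alpha> x z) = 1 - \<alpha>"
proof -
  have fin: "finite V" using simple_graph_finite[OF assms(1)] by simp
  have "(\<Sum>z\<in>V - {x}. lazy_measure E \<omega> \<alpha> x z)
      = (\<Sum>z | {x, z} \<in> E. (1 - \<alpha>) * \<omega> {x, z} / vertex_weight E \<omega> x)"
    using fin simple_graph_edge(2)[OF assms(1)] simple_graph_edge(3)[OF assms(1), of x x]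
    by (intro sum.mono_neutral_cong_right) (auto simp: lazy_measure_def)
  also have "\<dots> = (1 - \<alpha>) * vertex_weight E \<omega> x / vertex_weight E \<omega> x"
    by (simp add: vertex_weight_def sum_distrib_left sum_divide_distrib)
  finally show ?thesis using vertex_weight_pos[OF assms] by simp
qed

text \<open>
  The transport plan that is optimal on a graph without short cycles: the neighbours
  of \<open>x\<close> send their whole mass to \<open>y\<close>, the vertex \<open>x\<close> supplies all the neighbours
  of \<open>y\<close> (itself included), and the rest \<open>2 * \<alpha> - 1\<close> moves along the edge. This rest is
  nonnegative exactly when \<open>\<alpha> \<ge> 1/2\<close>, which is harmless because the curvature is a
  limit for \<open>\<alpha>\<close> tending to \<open>1\<close>.
\<close>

lemma lazy_coupling:
  assumes "simple_graph V E" "positive_weight E \<omega>" "{x, y} \<in> E" "1/2 \<le> \<alpha>" "\<alpha> \<le> 1"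
  shows "coupling V (lazy_measure E \<omega> \<alpha> x) (lazy_measure E \<omega> \<alpha> y)
    (\<lambda>u v. if u = x then if v = y then 2 * \<alpha> - 1 else lazy_measure E \<omega> \<alpha> y v
           else if v = y then lazy_measure E \<omega> \<alpha> x u else 0)"
    (is "coupling V ?\<mu> ?\<nu> ?\<pi>")
proof -
  note edge = simple_graph_edge[OF assms(1,3)]
  have fin: "finite V" using simple_graph_finite[OF assms(1)] by simp
  have yx: "{y, x} \<in> E" using assms(3) by (simp add: insert_commute)
  have "(\<Sum>v\<in>V. ?\<pi> u v) = ?\<mu> u" if "u \<in> V" for u
  proof (cases "u = x")
    case True
    have "(\<Sum>v\<in>V. ?\<pi> x v) = 2 * \<alpha> - 1 + (\<Sum>v\<in>V - {y}. ?\<nu> v)"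
      using edge fin by (subst sum.remove[of _ y]) (auto intro!: sum.cong)
    then show ?thesis
      unfolding True sum_lazy_measure_off_centre[OF assms(1,2) yx]
      by (simp add: lazy_measure_self)
  next
    case False
    then show ?thesis using fin edge by (simp add: sum.delta)
  qed
  moreover have "(\<Sum>u\<in>V. ?\<pi> u v) = ?\<nu> v" if "v \<in> V" for v
  proof (cases "v = y")
    case True
    have "(\<Sum>u\<in>V. ?\<pi> u y) = 2 * \<alpha> - 1 + (\<Sum>u\<in>V - {x}. ?\<mu> u)"
      using edge fin by (subst sum.remove[of _ x]) (auto intro!: sum.cong)
    then show ?thesis
      unfolding True sum_lazy_measure_off_centre[OF assms(1,2,3)]
      by (simp add: lazy_measure_self)
  next
    case False
    then show ?thesis using fin edge by (simp add: sum.delta cong: if_cong)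
  qed
  ultimately show ?thesis
    using lazy_measure_nonneg[OF assms(1,2)] assms(4,5) by (auto simp: coupling_def)
qed

text \<open>
  The potential takes the values \<open>2, 1, 0, - 1\<close> on the neighbours of \<open>x\<close>, on \<open>x\<close>,
  on \<open>y\<close> and on the neighbours of \<open>y\<close>, as on the path with these four kinds of
  vertices. It is 1-Lipschitz between the supports because in the absence of short cycles
  the distances are those of a tree, and the plan above connects only points between
  which the potential drops by their full distance.
\<close>

lemma wasserstein_lazy_edge:
  assumes "connected_graph V E" "6 \<le> girth V E" "positive_weight E \<omega>" "{x, y} \<in> E"
    and "1/2 \<le> \<alpha>" "\<alpha> < 1"
  shows "wasserstein V E (lazy_measure E \<omega> \<alpha> x) (lazy_measure E \<omega> \<alpha> y)
    = 1 - (1 - \<alpha>) * (2 * \<omega> {x, y} / vertex_weight E \<omega> x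
                     + 2 * \<omega> {x, y} / vertex_weight E \<omega> y - 2)"
proof -
  let ?\<mu> = "lazy_measure E \<omega> \<alpha> x" and ?\<nu> = "lazy_measure E \<omega> \<alpha> y"
  have G: "simple_graph V E" using assms(1) by (simp add: connected_graph_def)
  have fin: "finite V" using simple_graph_finite[OF G] by simp
  have yx: "{y, x} \<in> E" using assms(4) by (simp add: insert_commute)
  note edge = simple_graph_edge[OF G assms(4)]
  define f :: "'a \<Rightarrow> real" where
    "f z = (if z = x then 1 else if z = y then 0 else if {x, z} \<in> E then 2 else - 1)" for z
  have tri: "{x, z} \<notin> E" if "{y, z} \<in> E" for z
    using no_triangle[OF G assms(2,4) that] by (auto simp: insert_commute)
  have f1: "f x = 1" and f0: "f y = 0" using edge by (auto simp: f_def)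
  have f2: "f z = 2" if "{x, z} \<in> E" "z \<noteq> y" for z
    using that simple_graph_edge[OF G that(1)] by (auto simp: f_def)
  have f3: "f z = - 1" if "{y, z} \<in> E" "z \<noteq> x" for z
    using that tri[OF that(1)] simple_graph_edge[OF G that(1)] by (auto simp: f_def)
  have sx: "z = x \<or> z = y \<or> {x, z} \<in> E \<and> z \<noteq> y \<and> z \<noteq> x" if "?\<mu> z \<noteq> 0" for z
    using that edge by (auto simp: lazy_measure_def split: if_splits)
  have sy: "z = x \<or> z = y \<or> {y, z} \<in> E \<and> z \<noteq> x \<and> z \<noteq> y" if "?\<nu> z \<noteq> 0" for z
    using that edge by (auto simp: lazy_measure_def split: if_splits)
  have f_\<mu>: "f z * ?\<mu> z = 2 * ?\<mu> z" if "z \<noteq> x" "z \<noteq> y" for z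
    using that sx[of z] f2[of z] by (cases "?\<mu> z = 0") auto
  have f_\<nu>: "f z * ?\<nu> z = - ?\<nu> z" if "z \<noteq> x" "z \<noteq> y" for z
    using that sy[of z] f3[of z] by (cases "?\<nu> z = 0") auto
  have d0: "graph_dist V E z z = 0" if "z \<in> V" for z
    using graph_dist_le_path_length[of V E z z "[z]"] that by (simp add: graph_path_def)
  have d1: "graph_dist V E x y \<le> 1"
    using graph_dist_le_path_length[of V E x y "[x, y]"] assms(4) edge
    by (simp add: graph_path_def)
  have dx: "graph_dist V E u y \<le> 2" if "{x, u} \<in> E" "u \<noteq> y" for u
    using graph_dist_le_path_length[of V E u y "[u, x, y]"] that assms(4) edge
      simple_graph_edge[OF G that(1)]
    by (auto simp: graph_path_def insert_commute)
  have dy: "graph_dist V E x v \<le> 2" if "{y, v} \<in> E" "v \<noteq> x" for v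
    using graph_dist_le_path_length[of V E x v "[x, y, v]"] that assms(4) edge
      simple_graph_edge[OF G that(1)]
    by (auto simp: graph_path_def insert_commute)
  have ne: "1 \<le> graph_dist V E u v" if "u \<noteq> v" "u \<in> V" "v \<in> V" for u v
    using graph_dist_cases[OF assms(1) that(2,3)] that(1) by auto
  have lower_x: "2 \<le> graph_dist V E u y" if "{x, u} \<in> E" "u \<noteq> y" for u
    using dist_neighbour_across_edge[OF assms(1,2,4) that] .
  have lower_y: "2 \<le> graph_dist V E x v" if "{y, v} \<in> E" "v \<noteq> x" for v
    using dist_neighbour_across_edge[OF assms(1,2) yx that] by (simp add: graph_dist_commute)
  have "wasserstein V E ?\<mu> ?\<nu> = (\<Sum>u\<in>V. f u * ?\<mu> u) - (\<Sum>v\<in>V. f v * ?\<nu> v)"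
  proof (rule wasserstein_eq_dual[OF fin lazy_coupling[OF G assms(3,4)]])
    show "f u - f v \<le> real (graph_dist V E u v)"
      if uv: "u \<in> V" "v \<in> V" and supp: "?\<mu> u \<noteq> 0" "?\<nu> v \<noteq> 0" for u v
    proof -
      consider "u = v" | "u = x" "v = y" | "u = y" "v = x"
        | "u = x" "{y, v} \<in> E" "v \<noteq> x" | "u = y" "{y, v} \<in> E" "v \<noteq> x" "u \<noteq> v"
        | "{x, u} \<in> E" "u \<noteq> y" "v = x" "u \<noteq> v" | "{x, u} \<in> E" "u \<noteq> y" "v = y"
        | "{x, u} \<in> E" "u \<noteq> y" "{y, v} \<in> E" "v \<noteq> x"
        using sx[OF supp(1)] sy[OF supp(2)] by metis
      \<comment> \<open>In the cases left to \<open>auto\<close> the potential drops by at most 1.\<close>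
      then show ?thesis
      proof cases
        case 4
        then show ?thesis using lower_y[of v] f3[of v] f1 by simp
      next
        case 7
        then show ?thesis using lower_x[of u] f2[of u] f0 by simp
      next
        case 8
        then show ?thesis
          using dist_neighbours_of_edge[OF assms(1,2,4), of u v] f2[of u] f3[of v] by simp
      qed (use ne[OF _ uv] f0 f1 f2[of u] f3[of v] edge in auto)
    qed
  next
    show "real (graph_dist V E u v) \<le> f u - f v"
      if uv: "u \<in> V" "v \<in> V"
        and supp: "(if u = x then if v = y then 2 * \<alpha> - 1 else ?\<nu> v
              else if v = y then ?\<mu> u else 0) \<noteq> 0" for u v
    proof -
      consider "u = x" "v = y" | "u = x" "v \<noteq> y" "?\<nu> v \<noteq> 0" | "u \<noteq> x" "v = y" "?\<mu> u \<noteq> 0"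
        using supp by (metis (full_types))
      then show ?thesis
      proof cases
        case 1
        then show ?thesis using d1 f0 f1 by simp
      next
        case 2
        then consider "v = x" | "{y, v} \<in> E" "v \<noteq> x" using sy by blast
        then show ?thesis using 2 dy[of v] d0[OF uv(1)] f3[of v] f1 by cases auto
      next
        case 3
        then consider "u = y" | "{x, u} \<in> E" "u \<noteq> y" using sx by blast
        then show ?thesis using 3 dx[of u] d0[OF uv(1)] f2[of u] f0 by cases auto
      qed
    qed
  qed (use assms(5,6) in auto)
  also have "(\<Sum>u\<in>V. f u * ?\<mu> u) = \<alpha> + 2 * (1 - \<alpha> - ?\<mu> y)"
  proof -
    have "(\<Sum>u\<in>V - {x}. f u * ?\<mu> u) = (\<Sum>u\<in>V - {x} - {y}. 2 * ?\<mu> u)"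
      using fin edge f0 by (subst sum.remove[of _ y]) (auto simp: f_\<mu> intro!: sum.cong)
    also have "\<dots> = 2 * ((\<Sum>u\<in>V - {x}. ?\<mu> u) - ?\<mu> y)"
      using fin edge by (subst sum.remove[of _ y]) (auto simp: sum_distrib_left)
    finally show ?thesis
      using fin edge sum_lazy_measure_off_centre[OF G assms(3,4), of \<alpha>] f1
      by (subst sum.remove[of _ x]) (auto simp: lazy_measure_self)
  qed
  also have "(\<Sum>v\<in>V. f v * ?\<nu> v) = ?\<nu> x - (1 - \<alpha> - ?\<nu> x)"
  proof -
    have "(\<Sum>v\<in>V - {y}. f v * ?\<nu> v) = ?\<nu> x + (\<Sum>v\<in>V - {y} - {x}. - ?\<nu> v)"
      using fin edge f1 by (subst sum.remove[of _ x]) (auto simp: f_\<nu> intro!: sum.cong)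
    also have "(\<Sum>v\<in>V - {y} - {x}. - ?\<nu> v) = - ((\<Sum>v\<in>V - {y}. ?\<nu> v) - ?\<nu> x)"
      using fin edge by (subst sum.remove[of "V - {y}" x]) (auto simp: sum_negf)
    finally show ?thesis
      using fin edge sum_lazy_measure_off_centre[OF G assms(3) yx, of \<alpha>] f0
      by (subst sum.remove[of _ y]) (auto simp: lazy_measure_self)
  qed
  also have "?\<mu> y = (1 - \<alpha>) * (\<omega> {x, y} / vertex_weight E \<omega> x)"
    using edge assms(4) by (simp add: lazy_measure_def)
  also have "?\<nu> x = (1 - \<alpha>) * (\<omega> {x, y} / vertex_weight E \<omega> y)"
    using edge yx by (simp add: lazy_measure_def insert_commute)
  finally show ?thesis by (simp add: algebra_simps)
qed

lemma lly_curvature_girth_ge_6: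
  assumes "connected_graph V E" "6 \<le> girth V E" "positive_weight E \<omega>" "e \<in> E"
  shows "lly_curvature V E \<omega> e = 2 * (\<Sum>x\<in>e. \<omega> e / (\<Sum>f\<in>edges_at E x. \<omega> f)) - 2"
proof -
  have G: "simple_graph V E" using assms(1) by (simp add: connected_graph_def)
  obtain x y where e: "e = {x, y}" "x \<noteq> y" "x \<in> V" "y \<in> V"
    using simple_graph_edgeE[OF G assms(4)] .
  let ?k = "2 * \<omega> {x, y} / vertex_weight E \<omega> x + 2 * \<omega> {x, y} / vertex_weight E \<omega> y - 2"
  have "eventually (\<lambda>\<alpha>. \<alpha> \<in> {1/2<..<1::real}) (at_left 1)"
    by (rule eventually_at_leftI[of "1/2"]) auto
  then have "eventually (\<lambda>\<alpha>. 1 / (1 - \<alpha>) *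
      (1 - wasserstein V E (lazy_measure E \<omega> \<alpha> x) (lazy_measure E \<omega> \<alpha> y)) = ?k) (at_left 1)"
    by eventually_elim
      (use assms e in \<open>simp add: wasserstein_lazy_edge\<close>)
  then have "lly_curvature_pair V E \<omega> x y = ?k"
    unfolding lly_curvature_pair_def
    by (intro tendsto_Lim tendsto_eventually) auto
  then show ?thesis
    using e lly_curvature_edge[of V E \<omega> x y]
    by (simp add: vertex_weight_eq_sum_edges_at[OF G] algebra_simps)
qed

section \<open>Softmax\<close>

text \<open>
  For \<open>\<omega> = exp r\<close>, the share \<open>\<omega>\<^sub>e / m(x)\<close> of an edge in the weight of its endpoint
  \<open>x\<close> is the softmax of \<open>r\<close> over the edges at \<open>x\<close>, that is, the gradient of the convex
  function \<open>ln (\<Sum>j\<in>S. exp (r j))\<close>. Its Lipschitz continuity gives existence of the flow,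
  and its monotonicity gives uniqueness and convergence.
\<close>

definition softmax :: "'i set \<Rightarrow> ('i \<Rightarrow> real) \<Rightarrow> 'i \<Rightarrow> real" where
  "softmax S r i = exp (r i) / (\<Sum>j\<in>S. exp (r j))"

lemma sum_exp_pos:
  fixes r :: "'i \<Rightarrow> real"
  assumes "finite S" "i \<in> S"
  shows "0 < (\<Sum>j\<in>S. exp (r j))"
  using assms by (intro sum_pos) auto

lemma softmax_pos:
  assumes "finite S" "i \<in> S"
  shows "0 < softmax S r i"
  using sum_exp_pos[OF assms, of r] by (simp add: softmax_def)

lemma sum_softmax:
  assumes "finite S" "S \<noteq> {}"
  shows "(\<Sum>i\<in>S. softmax S r i) = 1"
proof -
  obtain i where "i \<in> S" using assms(2) by blast
  then show ?thesis
    using sum_exp_pos[OF assms(1), of i r] by (simp add: softmax_def flip: sum_divide_distrib)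
qed

lemma softmax_le_1:
  assumes "finite S" "i \<in> S"
  shows "softmax S r i \<le> 1"
proof -
  have "softmax S r i \<le> (\<Sum>j\<in>S. softmax S r j)"
    using assms by (intro member_le_sum) (auto intro: less_imp_le softmax_pos)
  also have "\<dots> = 1" using assms by (intro sum_softmax) auto
  finally show ?thesis .
qed

lemma softmax_add_const: "softmax S (\<lambda>i. r i + c) = softmax S r"
  by (simp add: softmax_def exp_add fun_eq_iff flip: sum_distrib_right)

lemma sum_exp_le:
  fixes r s :: "'i \<Rightarrow> real"
  assumes "\<And>j. j \<in> S \<Longrightarrow> r j \<le> s j + \<delta>"
  shows "(\<Sum>j\<in>S. exp (r j)) \<le> exp \<delta> * (\<Sum>j\<in>S. exp (s j))"
  unfolding sum_distrib_left
  using assms by (intro sum_mono) (simp add: algebra_simps flip: exp_add)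

lemma softmax_ratio:
  assumes "finite S" "i \<in> S" "\<And>j. j \<in> S \<Longrightarrow> \<bar>r j - s j\<bar> \<le> \<delta>"
  shows "softmax S r i \<le> exp (2 * \<delta>) * softmax S s i"
proof -
  let ?A = "\<Sum>j\<in>S. exp (r j)" and ?B = "\<Sum>j\<in>S. exp (s j)"
  have pos: "0 < ?A" "0 < ?B" using assms by (auto intro: sum_exp_pos)
  have "exp (r i) \<le> exp \<delta> * exp (s i)"
    using assms(3)[OF assms(2)] by (simp flip: exp_add)
  moreover have "?B \<le> exp \<delta> * ?A"
    using assms(3) by (intro sum_exp_le) force
  ultimately have "exp (r i) * ?B \<le> (exp \<delta> * exp (s i)) * (exp \<delta> * ?A)"
    using pos by (intro mult_mono) auto
  also have "\<dots> = exp (2 * \<delta>) * exp (s i) * ?A"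
  proof -
    have "exp (2 * \<delta>) = exp \<delta> * exp \<delta>" by (simp only: mult_2 exp_add)
    then show ?thesis by (simp add: mult_ac)
  qed
  finally show ?thesis
    using pos by (simp add: softmax_def field_simps)
qed

text \<open>
  Moving every coordinate by at most \<open>\<delta>\<close> changes numerator and denominator by factors
  between \<open>exp (- \<delta>)\<close> and \<open>exp \<delta>\<close>; as softmax is at most 1, the ratio bound turns into
  an absolute one through \<open>1 - exp (- 2 * \<delta>) \<le> 2 * \<delta>\<close>.
\<close>

lemma softmax_lipschitz:
  assumes "finite S" "i \<in> S" "\<And>j. j \<in> S \<Longrightarrow> \<bar>r j - s j\<bar> \<le> \<delta>"
  shows "\<bar>softmax S r i - softmax S s i\<bar> \<le> 2 * \<delta>"
proof -
  have one_sided: "softmax S r i - softmax S s i \<le> 2 * \<delta>"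
    if "\<And>j. j \<in> S \<Longrightarrow> \<bar>r j - s j\<bar> \<le> \<delta>" for r s
  proof -
    have "0 \<le> \<delta>" using that[OF assms(2)] by linarith
    have "exp (- (2 * \<delta>)) * softmax S r i
        \<le> exp (- (2 * \<delta>)) * (exp (2 * \<delta>) * softmax S s i)"
      using softmax_ratio[OF assms(1,2) that] by simp
    then have "exp (- (2 * \<delta>)) * softmax S r i \<le> softmax S s i"
      by (simp flip: exp_add mult.assoc)
    then have "softmax S r i - softmax S s i \<le> softmax S r i * (1 - exp (- (2 * \<delta>)))"
      by (simp add: algebra_simps)
    also have "\<dots> \<le> 1 * (2 * \<delta>)"
      using softmax_le_1[OF assms(1,2), of r] softmax_pos[OF assms(1,2), of r]
        exp_ge_add_one_self[of "- (2 * \<delta>)"] \<open>0 \<le> \<delta>\<close>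
      by (intro mult_mono) (simp_all add: algebra_simps)
    finally show ?thesis by simp
  qed
  have "softmax S r i - softmax S s i \<le> 2 * \<delta>" using assms(3) by (rule one_sided)
  moreover have "softmax S s i - softmax S r i \<le> 2 * \<delta>"
    using assms(3) by (intro one_sided) (simp add: abs_minus_commute)
  ultimately show ?thesis by linarith
qed

text \<open>
  The derivative of \<open>exp\<close> is at least \<open>exp (- R)\<close> to the right of \<open>- R\<close>.
\<close>

lemma exp_diff_strongly_monotone:
  fixes a b R :: real
  assumes "- R \<le> a" "- R \<le> b"
  shows "exp (- R) * (a - b)\<^sup>2 \<le> (exp a - exp b) * (a - b)"
proof -
  have le: "exp (- R) * (a - b)\<^sup>2 \<le> (exp a - exp b) * (a - b)" if "- R \<le> b" "b \<le> a" for a b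
  proof -
    have "exp (- R) * (a - b) \<le> exp b * (exp (a - b) - 1)"
      using that exp_ge_add_one_self[of "a - b"]
      by (intro mult_mono) (auto simp del: exp_ge_add_one_self)
    also have "\<dots> = exp a - exp b" by (simp add: algebra_simps flip: exp_add)
    finally have "exp (- R) * (a - b) * (a - b) \<le> (exp a - exp b) * (a - b)"
      using that by (intro mult_right_mono) auto
    then show ?thesis by (simp add: power2_eq_square mult.assoc)
  qed
  show ?thesis
  proof (cases "b \<le> a")
    case True
    then show ?thesis using le assms by blast
  next
    case False
    then show ?thesis using le[of a b] assms le[of a b]
      le[OF assms(1), of b] by (simp add: power2_commute[of a b] algebra_simps)
  qed
qed

text \<open>
  Write \<open>z = r - s\<close>, and let \<open>A\<close> and \<open>B\<close> be the two denominators. Symmetrizing the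
  double sum over \<open>i\<close> and \<open>j\<close>, as in the proof of Chebyshev's sum inequality, gives the
  identity
    \<open>2 * (\<Sum>i. (softmax r i - softmax s i) * z i)
      = (\<Sum>i j. exp (s i) * exp (s j) * (exp (z i) - exp (z j)) * (z i - z j)) / (A * B)\<close>,
  in which every summand is nonnegative. Only differences of \<open>z\<close> can occur, as softmax
  is invariant under adding a constant.
\<close>

lemma softmax_strongly_monotone:
  assumes "finite S" "\<And>i. i \<in> S \<Longrightarrow> \<bar>r i - s i\<bar> \<le> R"
    and "0 \<le> q" "\<And>i. i \<in> S \<Longrightarrow> q \<le> softmax S s i"
  shows "q\<^sup>2 * exp (- 2 * R) / 2 * (\<Sum>i\<in>S. \<Sum>j\<in>S. ((r i - s i) - (r j - s j))\<^sup>2)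
    \<le> (\<Sum>i\<in>S. (softmax S r i - softmax S s i) * (r i - s i))"
proof (cases "S = {}")
  case False
  then obtain k where k: "k \<in> S" by blast
  define z where "z i = r i - s i" for i
  define a where "a i = exp (r i)" for i
  define b where "b i = exp (s i)" for i
  define A where "A = (\<Sum>i\<in>S. a i)"
  define B where "B = (\<Sum>i\<in>S. b i)"
  have pos: "0 < A" "0 < B"
    using sum_exp_pos[OF assms(1) k] by (simp_all add: A_def B_def a_def b_def)
  have ab: "a i = b i * exp (z i)" for i by (simp add: a_def b_def z_def flip: exp_add)
  have "(\<Sum>i\<in>S. (softmax S r i - softmax S s i) * z i)
      = (\<Sum>i\<in>S. (a i * B - b i * A) * z i / (A * B))"
    using pos by (intro sum.cong) (simp_all add: softmax_def a_def b_def A_def B_def field_simps)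
  also have "\<dots> = (\<Sum>i\<in>S. \<Sum>j\<in>S. (a i * b j - b i * a j) * z i / (A * B))"
    by (simp add: A_def B_def sum_distrib_left sum_distrib_right sum_subtractf sum_divide_distrib
        left_diff_distrib diff_divide_distrib)
  finally have half1: "(\<Sum>i\<in>S. (softmax S r i - softmax S s i) * z i)
      = (\<Sum>i\<in>S. \<Sum>j\<in>S. (a i * b j - b i * a j) * z i / (A * B))" .
  also have "\<dots> = (\<Sum>i\<in>S. \<Sum>j\<in>S. (a j * b i - b j * a i) * z j / (A * B))"
    by (rule sum.swap)
  finally have half2: "(\<Sum>i\<in>S. (softmax S r i - softmax S s i) * z i)
      = (\<Sum>i\<in>S. \<Sum>j\<in>S. (a j * b i - b j * a i) * z j / (A * B))" .
  \<comment> \<open>The two expressions differ by exchanging \<open>i\<close> and \<open>j\<close>; their sum is the identity above.\<close>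
  have "2 * (\<Sum>i\<in>S. (softmax S r i - softmax S s i) * z i)
      = (\<Sum>i\<in>S. \<Sum>j\<in>S. (a i * b j - b i * a j) * z i / (A * B))
      + (\<Sum>i\<in>S. \<Sum>j\<in>S. (a j * b i - b j * a i) * z j / (A * B))"
    using half1 half2 by linarith
  also have "\<dots> = (\<Sum>i\<in>S. \<Sum>j\<in>S. b i * b j * ((exp (z i) - exp (z j)) * (z i - z j)) / (A * B))"
    unfolding sum.distrib[symmetric] add_divide_distrib[symmetric]
    by (intro sum.cong refl arg_cong2[where f = divide]) (simp add: ab algebra_simps)
  also have "\<dots> \<ge> (\<Sum>i\<in>S. \<Sum>j\<in>S. q\<^sup>2 * exp (- 2 * R) * (z i - z j)\<^sup>2)"
  proof (intro sum_mono)
    fix i j assume ij: "i \<in> S" "j \<in> S"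
    have zi: "- R \<le> z i" "- R \<le> z j" using assms(2)[of i] assms(2)[of j] ij by (auto simp: z_def)
    have "A \<le> exp R * B"
      unfolding A_def B_def a_def b_def using assms(2) by (intro sum_exp_le) force
    then have "exp (- R) * A \<le> exp (- R) * (exp R * B)" by simp
    then have AB: "exp (- R) * A \<le> B" by (simp flip: exp_add mult.assoc)
    have "q * B \<le> b i" "q * B \<le> b j"
      using assms(4)[of i] assms(4)[of j] ij pos
      by (simp_all add: softmax_def b_def B_def pos_le_divide_eq)
    then have "(q * B) * (q * B) \<le> b i * b j"
      using pos assms(3) by (intro mult_mono) (auto simp: b_def)
    moreover have "(q * B) * (q * (exp (- R) * A)) \<le> (q * B) * (q * B)"
      using AB pos assms(3) by (intro mult_left_mono) auto
    ultimately have "q\<^sup>2 * exp (- R) * (A * B) \<le> b i * b j"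
      by (simp add: power2_eq_square mult_ac)
    then have "q\<^sup>2 * exp (- R) \<le> b i * b j / (A * B)"
      using pos by (simp add: pos_le_divide_eq)
    then have "q\<^sup>2 * exp (- R) * (exp (- R) * (z i - z j)\<^sup>2)
        \<le> b i * b j / (A * B) * ((exp (z i) - exp (z j)) * (z i - z j))"
      using pos by (intro mult_mono[OF _ exp_diff_strongly_monotone[OF zi]]) (auto simp: b_def)
    moreover have "exp (- 2 * R) = exp (- R) * exp (- R)" by (simp flip: exp_add)
    ultimately show "q\<^sup>2 * exp (- 2 * R) * (z i - z j)\<^sup>2
        \<le> b i * b j * ((exp (z i) - exp (z j)) * (z i - z j)) / (A * B)"
      by (simp add: mult_ac)
  qed
  finally have "q\<^sup>2 * exp (- 2 * R) * (\<Sum>i\<in>S. \<Sum>j\<in>S. (z i - z j)\<^sup>2)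
      \<le> 2 * (\<Sum>i\<in>S. (softmax S r i - softmax S s i) * z i)"
    by (simp only: sum_distrib_left)
  then show ?thesis by (simp add: z_def)
qed simp

section \<open>Global solutions of Lipschitz differential equations\<close>

lemma integral_has_vector_derivative_atLeast:
  fixes h :: "real \<Rightarrow> 'b::banach"
  assumes "continuous_on UNIV h" "0 \<le> t"
  shows "((\<lambda>u. integral {0..u} h) has_vector_derivative h t) (at t within {0..})"
proof -
  have "((\<lambda>u. integral {0..u} h) has_vector_derivative h t) (at t within {0..t + 1})"
    using assms by (intro integral_has_vector_derivative) (auto intro: continuous_on_subset)
  moreover have "at t within {0..t + 1} = at t within {0..}"
    by (rule at_within_nhd[where S = "{..<t + 1}"]) auto
  ultimately show ?thesis by simp
qed

lemma norm_integral_le_exp: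
  fixes h :: "real \<Rightarrow> 'b::banach"
  assumes "continuous_on UNIV h" "0 < K" "0 \<le> t"
    and "\<And>s. 0 \<le> s \<Longrightarrow> norm (h s) \<le> c * exp (2 * K * s)"
  shows "norm (integral {0..t} h) \<le> c * exp (2 * K * t) / (2 * K)"
proof -
  let ?P = "\<lambda>s. c * exp (2 * K * s) / (2 * K)"
  have "0 \<le> norm (h 0)" by simp
  also have "\<dots> \<le> c" using assms(4)[of 0] by simp
  finally have c: "0 \<le> c" .
  have P: "((\<lambda>s. c * exp (2 * K * s)) has_integral (?P t - ?P 0)) {0..t}"
    using assms(2,3)
    by (intro fundamental_theorem_of_calculus)
       (auto intro!: derivative_eq_intros simp flip: has_real_derivative_iff_has_vector_derivative)
  have "norm (integral {0..t} h) \<le> integral {0..t} (\<lambda>s. c * exp (2 * K * s))"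
    using assms P
    by (intro integral_norm_bound_integral integrable_continuous_real)
       (auto intro: continuous_on_subset intro!: continuous_intros)
  also have "\<dots> = ?P t - ?P 0" using P by (rule integral_unique)
  also have "\<dots> \<le> ?P t" using c assms(2) by simp
  finally show ?thesis .
qed

text \<open>
  A globally Lipschitz vector field on a Banach space has a solution on all of
  \<open>{0..}\<close>. The unknown is rescaled to \<open>exp (- 2 * K * t) *\<^sub>R (x t - x0)\<close>: with this
  exponential weight the integral operator is a contraction with constant \<open>1/2\<close> on the
  bounded continuous functions on the whole line at once, so that no local solutions
  have to be glued. Replacing \<open>t\<close> by \<open>max 0 t\<close> extends functions continuously to
  negative times.
\<close>

lemma picard_lindelof_global:
  fixes G :: "'b::banach \<Rightarrow> 'b"
  assumes "0 < K" and lip: "\<And>x y. dist (G x) (G y) \<le> K * dist x y"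
  shows "\<exists>x. x 0 = x0 \<and> (\<forall>t\<ge>0. (x has_vector_derivative G (x t)) (at t within {0..}))"
proof -
  have contG: "continuous_on UNIV G"
  proof (rule lipschitz_on_continuous_on)
    show "K-lipschitz_on UNIV G" using assms by (intro lipschitz_onI) auto
  qed
  define h :: "(real \<Rightarrow>\<^sub>C 'b) \<Rightarrow> real \<Rightarrow> 'b" where
    "h y s = G (x0 + exp (2 * K * s) *\<^sub>R y s)" for y s
  have conth: "continuous_on UNIV (h y)" for y
    unfolding h_def by (intro continuous_on_compose2[OF contG] continuous_intros) auto
  define F :: "(real \<Rightarrow>\<^sub>C 'b) \<Rightarrow> real \<Rightarrow> 'b" where
    "F y t = exp (- (2 * K * max 0 t)) *\<^sub>R integral {0..max 0 t} (h y)" for y t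
  have hdiff: "norm (h y s - h z s) \<le> K * dist y z * exp (2 * K * s)" for y z s
  proof -
    have "norm (h y s - h z s) \<le> K * dist (x0 + exp (2 * K * s) *\<^sub>R y s) (x0 + exp (2 * K * s) *\<^sub>R z s)"
      using lip unfolding h_def dist_norm .
    also have "\<dots> = K * (exp (2 * K * s) * dist (y s) (z s))"
      by (simp add: dist_norm flip: scaleR_diff_right)
    also have "\<dots> \<le> K * (exp (2 * K * s) * dist y z)"
      using assms(1) by (intro mult_left_mono dist_bounded) auto
    finally show ?thesis by (simp add: mult_ac)
  qed
  \<comment> \<open>The weight turns the growth \<open>exp (2 * K * t) / (2 * K)\<close> of the integral into a constant.\<close>
  have scaled: "norm (exp (- (2 * K * max 0 t)) *\<^sub>R integral {0..max 0 t} g) \<le> c / (2 * K)"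
    if "continuous_on UNIV g" "\<And>s. 0 \<le> s \<Longrightarrow> norm (g s) \<le> c * exp (2 * K * s)"
    for g :: "real \<Rightarrow> 'b" and c t
  proof -
    have "norm (exp (- (2 * K * max 0 t)) *\<^sub>R integral {0..max 0 t} g)
        \<le> exp (- (2 * K * max 0 t)) * (c * exp (2 * K * max 0 t) / (2 * K))"
      unfolding norm_scaleR abs_exp_cancel
      by (intro mult_left_mono norm_integral_le_exp that assms(1)) auto
    also have "\<dots> = c / (2 * K)" by (simp add: exp_minus)
    finally show ?thesis .
  qed
  have Fdiff: "dist (F y t) (F z t) \<le> 1/2 * dist y z" for y z t
  proof -
    have "F y t - F z t
        = exp (- (2 * K * max 0 t)) *\<^sub>R integral {0..max 0 t} (\<lambda>s. h y s - h z s)"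
      unfolding F_def scaleR_diff_right[symmetric]
      by (subst integral_diff)
         (auto intro!: integrable_continuous_real continuous_on_subset[OF conth])
    moreover have "norm (exp (- (2 * K * max 0 t)) *\<^sub>R integral {0..max 0 t} (\<lambda>s. h y s - h z s))
        \<le> K * dist y z / (2 * K)"
      using hdiff by (intro scaled continuous_intros conth) auto
    ultimately show ?thesis using assms(1) by (simp add: dist_norm)
  qed
  have F_cont: "F y \<in> bcontfun" for y
  proof (rule bcontfun_normI)
    have "continuous_on {0..} (\<lambda>u. integral {0..u} (h y))"
      using integral_has_vector_derivative_atLeast[OF conth]
      by (auto simp: continuous_on_eq_continuous_within intro: has_vector_derivative_continuous)
    moreover have "continuous_on UNIV (\<lambda>t :: real. max 0 t)" by (intro continuous_intros)
    ultimately have "continuous_on UNIV (\<lambda>t. integral {0..max 0 t} (h y))"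
      by (rule continuous_on_compose2) auto
    then show "continuous_on UNIV (F y)"
      unfolding F_def by (intro continuous_intros)
  next
    fix t
    have "norm (h y s) \<le> (norm (G x0) + K * norm y) * exp (2 * K * s)" if "0 \<le> s" for s
    proof -
      have "norm (h y s) \<le> norm (h 0 s) + norm (h y s - h 0 s)"
        by (metis add.commute norm_triangle_sub)
      also have "\<dots> \<le> norm (G x0) * exp (2 * K * s) + K * dist y 0 * exp (2 * K * s)"
        using hdiff[of y s 0] that assms(1)
          mult_left_mono[of 1 "exp (2 * K * s)" "norm (G x0)"]
        by (intro add_mono) (simp_all add: h_def)
      finally show ?thesis by (simp add: algebra_simps)
    qed
    then show "norm (F y t) \<le> (norm (G x0) + K * norm y) / (2 * K)"
      unfolding F_def by (intro scaled conth) auto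
  qed
  have "\<exists>!y. Bcontfun (F y) = y"
    using Fdiff F_cont
    by (intro banach_fix_type[of "1/2"] allI dist_bound) (simp_all add: Bcontfun_inverse)
  then obtain y where y: "Bcontfun (F y) = y" by blast
  have Fy: "y t = F y t" for t using Bcontfun_inverse[OF F_cont[of y]] y by metis
  define x where "x t = x0 + integral {0..t} (h y)" for t
  have "x t = x0 + exp (2 * K * t) *\<^sub>R y t" if "0 \<le> t" for t
    using that unfolding x_def Fy[of t] by (simp add: F_def flip: exp_add)
  then have hx: "h y t = G (x t)" if "0 \<le> t" for t using that by (simp add: h_def)
  have "(x has_vector_derivative G (x t)) (at t within {0..})" if "0 \<le> t" for t
    using integral_has_vector_derivative_atLeast[OF conth that, of y] that
    unfolding x_def hx[OF that, symmetric, unfolded x_def]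
    by (auto intro!: derivative_eq_intros)
  moreover have "x 0 = x0" by (simp add: x_def)
  ultimately show ?thesis by blast
qed

instance bcontfun :: (metric_space, banach) banach ..

text \<open>
  The dimension of the system is the cardinality of a set, and hence not available as a
  type. Therefore \<open>I \<rightarrow> \<real>\<close> is embedded into the Banach space of bounded continuous functions
  on the line: the coordinates become the values at distinct natural numbers, and a tuple
  is interpolated by hat functions supported near these numbers.
\<close>

lemma lipschitz_system_global_solution:
  fixes g :: "('i \<Rightarrow> real) \<Rightarrow> 'i \<Rightarrow> real"
  assumes "finite I" "0 < K"
    and lip: "\<And>r s \<delta> i. (\<And>j. j \<in> I \<Longrightarrow> \<bar>r j - s j\<bar> \<le> \<delta>) \<Longrightarrow> i \<in> I \<Longrightarrow>
                \<bar>g r i - g s i\<bar> \<le> K * \<delta>"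
  shows "\<exists>r. (\<forall>i\<in>I. r 0 i = r0 i) \<and>
             (\<forall>t\<ge>0. \<forall>i\<in>I. ((\<lambda>s. r s i) has_real_derivative g (r t) i) (at t within {0..}))"
proof -
  obtain code :: "'i \<Rightarrow> nat" where code: "inj_on code I"
    using finite_imp_inj_to_nat_seg[OF assms(1)] by blast
  define hat :: "'i \<Rightarrow> real \<Rightarrow> real" where
    "hat i x = max 0 (1 - \<bar>x - real (code i)\<bar>)" for i x
  have hat01: "0 \<le> hat i x" "hat i x \<le> 1" for i x by (auto simp: hat_def)
  have hat_code: "hat j (code i) = (if j = i then 1 else 0)" if "i \<in> I" "j \<in> I" for i j
  proof (cases "j = i")
    case False
    then have "code i \<noteq> code j" using code that by (auto dest: inj_onD)
    then have "1 \<le> \<bar>real (code i) - real (code j)\<bar>" by linarith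
    then show ?thesis using False by (simp add: hat_def)
  qed (simp add: hat_def)
  define vec :: "('i \<Rightarrow> real) \<Rightarrow> real \<Rightarrow>\<^sub>C real" where
    "vec r = Bcontfun (\<lambda>x. \<Sum>i\<in>I. r i * hat i x)" for r
  have vec: "vec r x = (\<Sum>i\<in>I. r i * hat i x)" for r x
  proof -
    have "(\<lambda>x. \<Sum>i\<in>I. r i * hat i x) \<in> bcontfun"
    proof (rule bcontfun_normI)
      show "continuous_on UNIV (\<lambda>x. \<Sum>i\<in>I. r i * hat i x)"
        unfolding hat_def by (intro continuous_intros)
      show "norm (\<Sum>i\<in>I. r i * hat i x) \<le> (\<Sum>i\<in>I. \<bar>r i\<bar>)" for x
        using hat01 by (intro sum_norm_le) (simp add: abs_mult mult_left_le)
    qed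
    then show ?thesis by (simp add: vec_def Bcontfun_inverse)
  qed
  have vec_code: "vec r (code i) = r i" if "i \<in> I" for r i
    using that assms(1) by (simp add: vec hat_code if_distrib[of "times _"] cong: if_cong)
  define G :: "(real \<Rightarrow>\<^sub>C real) \<Rightarrow> real \<Rightarrow>\<^sub>C real" where "G z = vec (g (\<lambda>i. z (code i)))" for z
  \<comment> \<open>A crude Lipschitz constant of the interpolated field: every hat function is bounded
    by 1. The summand 1 makes it positive when \<open>I\<close> is empty.\<close>
  define M where "M = 1 + card I * K"
  have "0 < M" using assms(2) by (simp add: M_def add_pos_nonneg)
  have "dist (G z) (G w) \<le> M * dist z w" for z w
  proof (rule dist_bound)
    fix x
    have "\<bar>z (code i) - w (code i)\<bar> \<le> dist z w" for i
      using dist_bounded[of z "code i" w] by (simp add: dist_real_def)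
    then have gle: "\<bar>g (\<lambda>i. z (code i)) i - g (\<lambda>i. w (code i)) i\<bar> \<le> K * dist z w"
      if "i \<in> I" for i
      using that by (intro lip)
    have "dist (G z x) (G w x)
        = norm (\<Sum>i\<in>I. (g (\<lambda>i. z (code i)) i - g (\<lambda>i. w (code i)) i) * hat i x)"
      by (simp add: G_def vec dist_norm sum_subtractf left_diff_distrib)
    also have "\<dots> \<le> (\<Sum>i\<in>I. K * dist z w)"
    proof (rule sum_norm_le)
      fix i assume "i \<in> I"
      then show "norm ((g (\<lambda>i. z (code i)) i - g (\<lambda>i. w (code i)) i) * hat i x) \<le> K * dist z w"
        using mult_mono[OF gle[of i] hat01(2)[of i x]] hat01(1)[of i x] assms(2)
        by (simp add: abs_mult)
    qed
    also have "\<dots> \<le> M * dist z w" by (simp add: M_def distrib_right)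
    finally show "dist (G z x) (G w x) \<le> M * dist z w" .
  qed
  from picard_lindelof_global[OF \<open>0 < M\<close> this, of "vec r0"]
  obtain x where x0: "x 0 = vec r0"
    and x: "\<And>t. 0 \<le> t \<Longrightarrow> (x has_vector_derivative G (x t)) (at t within {0..})" by blast
  have eval: "bounded_linear (\<lambda>z :: real \<Rightarrow>\<^sub>C real. z k)" for k
    by (rule bounded_linear_intro[of _ 1]) (simp_all add: norm_bounded del: real_norm_def)
  have "((\<lambda>s. x s (code i)) has_real_derivative g (\<lambda>i. x t (code i)) i) (at t within {0..})"
    if "0 \<le> t" "i \<in> I" for t i
    using bounded_linear.has_vector_derivative[OF eval x[OF that(1)], of "code i"]
      vec_code[OF that(2)]
    by (simp add: G_def has_real_derivative_iff_has_vector_derivative)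
  then show ?thesis
    by (intro exI[of _ "\<lambda>t i. x t (code i)"]) (auto simp: x0 vec_code)
qed

text \<open>
  The function \<open>D t * exp (k * t)\<close> is nonincreasing.
\<close>

lemma gronwall_decay:
  fixes D D' :: "real \<Rightarrow> real"
  assumes "\<And>t. 0 \<le> t \<Longrightarrow> (D has_real_derivative D' t) (at t within {0..})"
    and "\<And>t. 0 \<le> t \<Longrightarrow> D' t \<le> - k * D t" and "0 \<le> t"
  shows "D t \<le> D 0 * exp (- k * t)"
proof -
  define f where "f s = D s * exp (k * s)" for s
  have der: "(f has_real_derivative (D' s + k * D s) * exp (k * s)) (at s within {0..})"
    if "0 \<le> s" for s
    unfolding f_def
    by (rule derivative_eq_intros assms(1)[OF that] refl | simp add: algebra_simps)+
  have "f 0 \<ge> f t"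
  proof (rule DERIV_nonpos_imp_decreasing_open[OF assms(3)])
    fix s assume "0 < s" "s < t"
    then have "at s within {0..} = at s" by (intro at_within_interior) (simp add: interior_real_atLeast)
    with der[of s] assms(2)[of s] \<open>0 < s\<close>
    show "\<exists>y. DERIV f s :> y \<and> y \<le> 0"
      by (intro exI[of _ "(D' s + k * D s) * exp (k * s)"]) (auto simp: mult_nonpos_nonneg)
  next
    have "continuous_on {0..} f" using der by (intro DERIV_continuous_on) auto
    then show "continuous_on {0..t} f" by (rule continuous_on_subset) auto
  qed
  then have "D t * exp (k * t) * exp (- k * t) \<le> D 0 * exp (- k * t)"
    by (intro mult_right_mono) (auto simp: f_def)
  then show ?thesis by (simp add: mult.assoc flip: exp_add)
qed

section \<open>Monotonicity of the curvature in logarithmic coordinates\<close>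

text \<open>
  The Lin-Lu-Yau curvature on a graph of girth at least 6 as a function of the
  logarithms \<open>r = ln \<omega>\<close> of the weights.
\<close>

definition log_curvature :: "'a set set \<Rightarrow> ('a set \<Rightarrow> real) \<Rightarrow> 'a set \<Rightarrow> real" where
  "log_curvature E r e = 2 * (\<Sum>x\<in>e. softmax (edges_at E x) r e) - 2"

lemma mem_edges_at: "e \<in> edges_at E x \<longleftrightarrow> e \<in> E \<and> x \<in> e"
  by (simp add: edges_at_def)

lemma finite_edges_at: "finite E \<Longrightarrow> finite (edges_at E x)"
  by (simp add: edges_at_def)

lemma lly_curvature_exp:
  assumes "connected_graph V E" "6 \<le> girth V E" "e \<in> E"
  shows "lly_curvature V E (\<lambda>f. exp (r f)) e = log_curvature E r e"
  using lly_curvature_girth_ge_6[OF assms(1,2) _ assms(3), of "\<lambda>f. exp (r f)"]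
  by (simp add: positive_weight_def log_curvature_def softmax_def)

lemma lly_curvature_ln:
  assumes "connected_graph V E" "6 \<le> girth V E" "positive_weight E \<omega>" "e \<in> E"
  shows "lly_curvature V E \<omega> e = log_curvature E (\<lambda>f. ln (\<omega> f)) e"
proof -
  have "exp (ln (\<omega> f)) = \<omega> f" if "f \<in> E" for f
    using assms(3) that by (simp add: positive_weight_def)
  then show ?thesis
    using lly_curvature_girth_ge_6[OF assms] assms(4)
    by (simp add: log_curvature_def softmax_def mem_edges_at)
qed

lemma log_curvature_add_const: "log_curvature E (\<lambda>e. r e + c) = log_curvature E r"
  by (simp add: log_curvature_def softmax_add_const fun_eq_iff)

lemma log_curvature_lipschitz:
  assumes "simple_graph V E" "\<And>f. f \<in> E \<Longrightarrow> \<bar>r f - s f\<bar> \<le> \<delta>" "e \<in> E"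
  shows "\<bar>log_curvature E r e - log_curvature E s e\<bar> \<le> 8 * \<delta>"
proof -
  obtain x y where e: "e = {x, y}" "x \<noteq> y" "x \<in> V" "y \<in> V"
    using simple_graph_edgeE[OF assms(1,3)] .
  have "\<bar>softmax (edges_at E v) r e - softmax (edges_at E v) s e\<bar> \<le> 2 * \<delta>" if "v \<in> e" for v
    using assms that simple_graph_finite[OF assms(1)]
    by (intro softmax_lipschitz finite_edges_at) (auto simp: mem_edges_at)
  from this[of x] this[of y] show ?thesis
    using e by (simp add: log_curvature_def)
qed

text \<open>
  Double counting of incident pairs of an edge and a vertex reduces statements about
  the whole graph to the softmax at a single vertex.
\<close>

lemma sum_log_curvature_diff:
  assumes "simple_graph V E"
  shows "(\<Sum>e\<in>E. (log_curvature E r e - log_curvature E s e) * w e)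
    = 2 * (\<Sum>x\<in>V. \<Sum>e\<in>edges_at E x.
        (softmax (edges_at E x) r e - softmax (edges_at E x) s e) * w e)"
proof -
  note fin = simple_graph_finite[OF assms]
  let ?d = "\<lambda>x e. (softmax (edges_at E x) r e - softmax (edges_at E x) s e) * w e"
  have "(log_curvature E r e - log_curvature E s e) * w e = 2 * (\<Sum>x | x \<in> V \<and> x \<in> e. ?d x e)"
    if "e \<in> E" for e
  proof -
    have "{x \<in> V. x \<in> e} = e" using simple_graph_edgeE[OF assms that] by blast
    then show ?thesis
      by (simp add: log_curvature_def sum_subtractf left_diff_distrib sum_distrib_right
          right_diff_distrib mult.assoc)
  qed
  then have "(\<Sum>e\<in>E. (log_curvature E r e - log_curvature E s e) * w e)
      = 2 * (\<Sum>e\<in>E. \<Sum>x | x \<in> V \<and> x \<in> e. ?d x e)"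
    by (simp add: sum_distrib_left)
  also have "(\<Sum>e\<in>E. \<Sum>x | x \<in> V \<and> x \<in> e. ?d x e) = (\<Sum>x\<in>V. \<Sum>e | e \<in> E \<and> x \<in> e. ?d x e)"
    using fin by (intro sum.swap_restrict)
  finally show ?thesis by (simp add: edges_at_def)
qed

text \<open>
  The shares of the edges at a vertex of positive degree add up to 1, so the total
  curvature is twice the number of these vertices minus twice the number of edges, for all
  weights.
\<close>

lemma sum_log_curvature_eq:
  assumes "simple_graph V E"
  shows "(\<Sum>e\<in>E. log_curvature E r e) = (\<Sum>e\<in>E. log_curvature E s e)"
proof -
  have "(\<Sum>e\<in>edges_at E x. softmax (edges_at E x) r e - softmax (edges_at E x) s e) = 0" for x
    using sum_softmax[OF finite_edges_at[OF simple_graph_finite(2)[OF assms]], of x]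
    by (cases "edges_at E x = {}") (auto simp: sum_subtractf)
  then show ?thesis
    using sum_log_curvature_diff[OF assms, of r s "\<lambda>_. 1"] by (simp add: sum_subtractf)
qed

text \<open>
  The Dirichlet energy of a function on the edges, with respect to the line graph,
  with every pair of edges counted in both orders.
\<close>

definition vertex_energy :: "'a set \<Rightarrow> 'a set set \<Rightarrow> ('a set \<Rightarrow> real) \<Rightarrow> real" where
  "vertex_energy V E z =
     (\<Sum>x\<in>V. \<Sum>e\<in>edges_at E x. \<Sum>f\<in>edges_at E x. (z e - z f)\<^sup>2)"

lemma vertex_energy_nonneg: "0 \<le> vertex_energy V E z"
  by (simp add: vertex_energy_def sum_nonneg)

lemma diff_sq_le_vertex_energy:
  assumes "finite V" "finite E" "x \<in> V" "e \<in> edges_at E x" "f \<in> edges_at E x"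
  shows "(z e - z f)\<^sup>2 \<le> vertex_energy V E z"
proof -
  note fin = finite_edges_at[OF assms(2)]
  have "(z e - z f)\<^sup>2 \<le> (\<Sum>f\<in>edges_at E x. (z e - z f)\<^sup>2)"
    using assms(5) fin by (intro member_le_sum[where f = "\<lambda>f. (z e - z f)\<^sup>2"]) auto
  also have "\<dots> \<le> (\<Sum>e\<in>edges_at E x. \<Sum>f\<in>edges_at E x. (z e - z f)\<^sup>2)"
    using assms(4) fin
    by (intro member_le_sum[where f = "\<lambda>e. \<Sum>f\<in>edges_at E x. (z e - z f)\<^sup>2"])
       (auto intro: sum_nonneg)
  also have "\<dots> \<le> vertex_energy V E z"
    unfolding vertex_energy_def using assms(1,3)
    by (intro member_le_sum[where f = "\<lambda>x. \<Sum>e\<in>edges_at E x. \<Sum>f\<in>edges_at E x. (z e - z f)\<^sup>2"])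
       (auto intro!: sum_nonneg)
  finally show ?thesis .
qed

text \<open>
  Consecutive edges of a path share a vertex, and the values of \<open>z\<close> at two edges
  sharing a vertex differ by at most the square root of the energy.
\<close>

lemma diff_le_path_length_energy:
  assumes "finite V" "finite E"
    and step: "e \<in> edges_at E u" and "f \<in> edges_at E v"
    and "p \<noteq> []" "hd p = u" "last p = v" "set p \<subseteq> V" "successively (\<lambda>a b. {a, b} \<in> E) p"
  shows "\<bar>z e - z f\<bar> \<le> length p * sqrt (vertex_energy V E z)"
  using assms(3-)
proof (induction p arbitrary: u e)
  case (Cons a p)
  have a: "a = u" "u \<in> V" using Cons.prems by auto
  show ?case
  proof (cases p)
    case Nil
    then have "f \<in> edges_at E u" using Cons.prems by auto
    from diff_sq_le_vertex_energy[OF assms(1,2) a(2) Cons.prems(1) this, of z]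
    have "\<bar>z e - z f\<bar> \<le> sqrt (vertex_energy V E z)" by (intro real_le_rsqrt) simp
    then show ?thesis using Nil by simp
  next
    case (Cons b p')
    then have ab: "{u, b} \<in> E" "successively (\<lambda>a b. {a, b} \<in> E) p"
      using Cons.prems(4,7) a Cons by (auto simp: successively_Cons)
    have "\<bar>z {u, b} - z f\<bar> \<le> length p * sqrt (vertex_energy V E z)"
    proof (rule Cons.IH[of _ b])
      show "{u, b} \<in> edges_at E b" using ab by (simp add: mem_edges_at)
      show "last p = v" using Cons.prems(5) Cons by simp
      show "set p \<subseteq> V" using Cons.prems(6) by simp
    qed (use Cons Cons.prems(2) ab in simp_all)
    moreover have "\<bar>z e - z {u, b}\<bar> \<le> sqrt (vertex_energy V E z)"
      using diff_sq_le_vertex_energy[OF assms(1,2) a(2) Cons.prems(1), of "{u, b}" z] ab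
      by (intro real_le_rsqrt) (simp add: mem_edges_at)
    ultimately show ?thesis by (simp add: algebra_simps)
  qed
qed simp

text \<open>
  A Poincare inequality for the line graph. By connectedness any two edges are joined
  by a path with at most \<open>card V\<close> vertices, so all values of \<open>z\<close> are close to each other,
  and hence close to their mean \<open>0\<close>.
\<close>

lemma poincare_edges:
  assumes "connected_graph V E" "(\<Sum>e\<in>E. z e) = 0"
  shows "(\<Sum>e\<in>E. (z e)\<^sup>2) \<le> card E * (card V)\<^sup>2 * vertex_energy V E z"
proof -
  have G: "simple_graph V E" using assms(1) by (simp add: connected_graph_def)
  note fin = simple_graph_finite[OF G]
  let ?B = "card V * sqrt (vertex_energy V E z)"
  have diff: "\<bar>z e - z f\<bar> \<le> ?B" if ef: "e \<in> E" "f \<in> E" for e f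
  proof -
    obtain u u' v v' where uv: "e = {u, u'}" "u \<in> V" "f = {v, v'}" "v \<in> V"
      using simple_graph_edgeE[OF G ef(1)] simple_graph_edgeE[OF G ef(2)] by metis
    obtain p where p: "graph_path V E u v p"
      using assms(1) uv by (auto simp: connected_graph_def)
    have "\<bar>z e - z f\<bar> \<le> length p * sqrt (vertex_energy V E z)"
      using p uv ef
      by (intro diff_le_path_length_energy[OF fin, of e u f v])
         (auto simp: graph_path_def mem_edges_at)
    also have "length p \<le> card V"
      using p fin by (metis card_mono distinct_card graph_path_def)
    then have "length p * sqrt (vertex_energy V E z) \<le> ?B"
      by (intro mult_right_mono) (auto simp: vertex_energy_nonneg)
    finally show ?thesis .
  qed
  have "(z e)\<^sup>2 \<le> (card V)\<^sup>2 * vertex_energy V E z" if "e \<in> E" for e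
  proof -
    have n: "0 < real (card E)" using that fin by (auto simp: card_gt_0_iff)
    have "card E * z e = (\<Sum>f\<in>E. z e - z f)"
      using assms(2) by (simp add: sum_subtractf)
    then have "card E * \<bar>z e\<bar> = \<bar>\<Sum>f\<in>E. z e - z f\<bar>" by (metis abs_mult abs_of_nat)
    also have "\<dots> \<le> (\<Sum>f\<in>E. \<bar>z e - z f\<bar>)" by (rule sum_abs)
    also have "\<dots> \<le> (\<Sum>f\<in>E. ?B)" using diff that by (intro sum_mono) auto
    finally have "\<bar>z e\<bar> \<le> ?B" using n by simp
    then have "\<bar>z e\<bar>\<^sup>2 \<le> ?B\<^sup>2" by (intro power_mono) auto
    then show ?thesis by (simp add: power_mult_distrib vertex_energy_nonneg)
  qed
  then have "(\<Sum>e\<in>E. (z e)\<^sup>2) \<le> (\<Sum>e\<in>E. (card V)\<^sup>2 * vertex_energy V E z)"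
    by (intro sum_mono) auto
  then show ?thesis by (simp add: mult.assoc)
qed

lemma log_curvature_monotone_energy:
  assumes "simple_graph V E" "\<And>e. e \<in> E \<Longrightarrow> \<bar>r e - s e\<bar> \<le> R"
    and "0 \<le> q" "\<And>x e. e \<in> edges_at E x \<Longrightarrow> q \<le> softmax (edges_at E x) s e"
  shows "q\<^sup>2 * exp (- 2 * R) * vertex_energy V E (\<lambda>e. r e - s e)
    \<le> (\<Sum>e\<in>E. (log_curvature E r e - log_curvature E s e) * (r e - s e))"
proof -
  have "(\<Sum>x\<in>V. q\<^sup>2 * exp (- 2 * R) / 2 *
          (\<Sum>e\<in>edges_at E x. \<Sum>f\<in>edges_at E x. ((r e - s e) - (r f - s f))\<^sup>2))
      \<le> (\<Sum>x\<in>V. \<Sum>e\<in>edges_at E x.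
          (softmax (edges_at E x) r e - softmax (edges_at E x) s e) * (r e - s e))"
    using assms simple_graph_finite[OF assms(1)]
    by (intro sum_mono softmax_strongly_monotone finite_edges_at) (auto simp: mem_edges_at)
  then show ?thesis
    unfolding sum_log_curvature_diff[OF assms(1)] vertex_energy_def sum_distrib_left[symmetric]
    by simp
qed

lemma log_curvature_monotone:
  assumes "simple_graph V E"
  shows "0 \<le> (\<Sum>e\<in>E. (log_curvature E r e - log_curvature E s e) * (r e - s e))"
proof -
  have fin: "finite E" using simple_graph_finite[OF assms] by simp
  have "0\<^sup>2 * exp (- 2 * (\<Sum>e\<in>E. \<bar>r e - s e\<bar>)) * vertex_energy V E (\<lambda>e. r e - s e)
    \<le> (\<Sum>e\<in>E. (log_curvature E r e - log_curvature E s e) * (r e - s e))"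
    using fin
    by (intro log_curvature_monotone_energy[OF assms])
       (auto intro!: member_le_sum less_imp_le[OF softmax_pos] finite_edges_at)
  then show ?thesis by simp
qed

text \<open>
  The curvature is the gradient of a convex function of \<open>r\<close>, up to a constant. This
  function is affine in the direction \<open>(1, \<dots>, 1)\<close>, because scaling the weights does not
  change the curvature. On the complement of this direction, and at bounded distance from
  \<open>s\<close>, the Poincare inequality makes it strongly convex.
\<close>

lemma log_curvature_strongly_monotone:
  assumes "connected_graph V E"
  shows "\<exists>k>0. \<forall>r. (\<Sum>e\<in>E. r e - s e) = 0 \<longrightarrow> (\<forall>e\<in>E. \<bar>r e - s e\<bar> \<le> R) \<longrightarrow>
           k * (\<Sum>e\<in>E. (r e - s e)\<^sup>2)
           \<le> (\<Sum>e\<in>E. (log_curvature E r e - log_curvature E s e) * (r e - s e))"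
proof -
  have G: "simple_graph V E" using assms by (simp add: connected_graph_def)
  note fin = simple_graph_finite[OF G]
  \<comment> \<open>The least share at \<open>s\<close>; the element 1 only keeps the set nonempty if there are no edges.\<close>
  define Q where "Q = insert 1 ((\<lambda>(x, e). softmax (edges_at E x) s e) ` (SIGMA x:V. edges_at E x))"
  define q where "q = Min Q"
  have finQ: "finite Q" unfolding Q_def using fin by (auto intro!: finite_SigmaI finite_edges_at)
  have "q \<in> Q" unfolding q_def using finQ by (intro Min_in) (auto simp: Q_def)
  moreover have "0 < a" if "a \<in> Q" for a
    using that fin by (auto simp: Q_def intro!: softmax_pos finite_edges_at)
  ultimately have q: "0 < q" by blast
  have q_le: "q \<le> softmax (edges_at E x) s e" if "e \<in> edges_at E x" for x e
  proof -
    have "x \<in> V" using that simple_graph_edgeE[OF G, of e] by (auto simp: mem_edges_at)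
    then show ?thesis using that finQ unfolding q_def by (intro Min_le) (auto simp: Q_def)
  qed
  \<comment> \<open>The Poincare constant, increased by 1 so that it is positive.\<close>
  define P where "P = 1 + card E * (card V)\<^sup>2"
  have P: "0 < real P" by (simp add: P_def add_pos_nonneg)
  show ?thesis
  proof (intro exI[of _ "q\<^sup>2 * exp (- 2 * R) / P"] conjI allI impI)
    show "0 < q\<^sup>2 * exp (- 2 * R) / P" using q P by simp
    fix r assume sum0: "(\<Sum>e\<in>E. r e - s e) = 0" and R: "\<forall>e\<in>E. \<bar>r e - s e\<bar> \<le> R"
    let ?D = "vertex_energy V E (\<lambda>e. r e - s e)"
    have "(\<Sum>e\<in>E. (r e - s e)\<^sup>2) \<le> card E * (card V)\<^sup>2 * ?D"
      using poincare_edges[OF assms sum0] .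
    also have "\<dots> \<le> P * ?D"
      unfolding P_def using vertex_energy_nonneg by (intro mult_right_mono) auto
    finally have "(\<Sum>e\<in>E. (r e - s e)\<^sup>2) / P \<le> ?D" using P by (simp add: field_simps)
    then have "q\<^sup>2 * exp (- 2 * R) * ((\<Sum>e\<in>E. (r e - s e)\<^sup>2) / P) \<le> q\<^sup>2 * exp (- 2 * R) * ?D"
      by (intro mult_left_mono) auto
    also have "\<dots> \<le> (\<Sum>e\<in>E. (log_curvature E r e - log_curvature E s e) * (r e - s e))"
      using q q_le R by (intro log_curvature_monotone_energy[OF G]) auto
    finally show "q\<^sup>2 * exp (- 2 * R) / P * (\<Sum>e\<in>E. (r e - s e)\<^sup>2)
        \<le> (\<Sum>e\<in>E. (log_curvature E r e - log_curvature E s e) * (r e - s e))"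
      by simp
  qed
qed

section \<open>The flow\<close>

text \<open>
  The flow for \<open>r = ln \<omega>\<close>. In these coordinates positivity of the weights is automatic,
  the vector field is bounded and Lipschitz, and it is minus the gradient of a convex
  function.
\<close>

definition log_flow :: "'a set set \<Rightarrow> ('a set \<Rightarrow> real) \<Rightarrow> (real \<Rightarrow> 'a set \<Rightarrow> real) \<Rightarrow> bool" where
  "log_flow E \<kappa>' r \<longleftrightarrow>
     (\<forall>t\<ge>0. \<forall>e\<in>E. ((\<lambda>s. r s e) has_real_derivative \<kappa>' e - log_curvature E (r t) e)
                        (at t within {0..}))"

lemma log_flow_ln_ricci_flow:
  assumes "connected_graph V E" "6 \<le> girth V E" "ricci_flow V E \<kappa>' \<omega>\<^sub>0 \<omega>"
  shows "log_flow E \<kappa>' (\<lambda>t e. ln (\<omega> t e))"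
  unfolding log_flow_def
proof (intro allI ballI impI)
  fix t :: real and e assume t: "0 \<le> t" and e: "e \<in> E"
  have pos: "positive_weight E (\<omega> t)"
    and der: "((\<lambda>s. \<omega> s e) has_real_derivative - (lly_curvature V E (\<omega> t) e - \<kappa>' e) * \<omega> t e)
                (at t within {0..})"
    using assms(3) t e by (auto simp: ricci_flow_def)
  have "0 < \<omega> t e" using pos e by (simp add: positive_weight_def)
  then have "((\<lambda>s. ln (\<omega> s e)) has_real_derivative \<kappa>' e - lly_curvature V E (\<omega> t) e)
      (at t within {0..})"
    by (auto intro!: derivative_eq_intros der)
  then show "((\<lambda>s. ln (\<omega> s e)) has_real_derivative
      \<kappa>' e - log_curvature E (\<lambda>e. ln (\<omega> t e)) e) (at t within {0..})"
    using lly_curvature_ln[OF assms(1,2) pos e] by simp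
qed

lemma ricci_flow_exp_log_flow:
  assumes "connected_graph V E" "6 \<le> girth V E" "log_flow E \<kappa>' r"
    and "\<And>e. e \<in> E \<Longrightarrow> exp (r 0 e) = \<omega>\<^sub>0 e"
  shows "ricci_flow V E \<kappa>' \<omega>\<^sub>0 (\<lambda>t e. exp (r t e))"
  unfolding ricci_flow_def
proof (intro conjI allI ballI impI)
  fix t :: real and e assume "0 \<le> t" and e: "e \<in> E"
  then have "((\<lambda>s. r s e) has_real_derivative \<kappa>' e - log_curvature E (r t) e) (at t within {0..})"
    using assms(3) by (simp add: log_flow_def)
  then show "((\<lambda>s. exp (r s e)) has_real_derivative
      - (lly_curvature V E (\<lambda>e. exp (r t e)) e - \<kappa>' e) * exp (r t e)) (at t within {0..})"
    unfolding lly_curvature_exp[OF assms(1,2) e] by (auto intro!: derivative_eq_intros)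
qed (use assms(4) in \<open>auto simp: positive_weight_def\<close>)

lemma log_flow_exists:
  assumes "simple_graph V E"
  obtains r where "log_flow E \<kappa>' r" "\<And>e. e \<in> E \<Longrightarrow> r 0 e = r0 e"
proof -
  have "\<bar>(\<kappa>' e - log_curvature E r e) - (\<kappa>' e - log_curvature E s e)\<bar> \<le> 8 * \<delta>"
    if "\<And>f. f \<in> E \<Longrightarrow> \<bar>r f - s f\<bar> \<le> \<delta>" "e \<in> E" for r s \<delta> e
    using log_curvature_lipschitz[OF assms, of r s \<delta> e] that by simp
  from lipschitz_system_global_solution[of E 8 "\<lambda>r e. \<kappa>' e - log_curvature E r e" r0,
      OF simple_graph_finite(2)[OF assms] _ this]
  show thesis using that unfolding log_flow_def by auto
qed

lemma log_flow_sq_dist_derivative: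
  assumes "log_flow E \<kappa>' r" "log_flow E \<kappa>' s" "0 \<le> t"
  shows "((\<lambda>t. \<Sum>e\<in>E. (r t e - s t e)\<^sup>2) has_real_derivative
      - 2 * (\<Sum>e\<in>E. (log_curvature E (r t) e - log_curvature E (s t) e) * (r t e - s t e)))
      (at t within {0..})"
proof -
  have "((\<lambda>t. \<Sum>e\<in>E. (r t e - s t e)\<^sup>2) has_real_derivative
      (\<Sum>e\<in>E. 2 * (r t e - s t e) *
        ((\<kappa>' e - log_curvature E (r t) e) - (\<kappa>' e - log_curvature E (s t) e)))) (at t within {0..})"
    using assms unfolding log_flow_def
    by (intro DERIV_sum) (auto intro!: derivative_eq_intros)
  then show ?thesis by (simp add: sum_distrib_left algebra_simps sum_negf flip: sum_subtractf)
qed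

text \<open>
  Two solutions of the gradient flow of a convex function do not move apart.
\<close>

lemma log_flow_contracts:
  assumes "simple_graph V E" "log_flow E \<kappa>' r" "log_flow E \<kappa>' s" "0 \<le> t"
  shows "(\<Sum>e\<in>E. (r t e - s t e)\<^sup>2) \<le> (\<Sum>e\<in>E. (r 0 e - s 0 e)\<^sup>2)"
proof -
  have "(\<Sum>e\<in>E. (r t e - s t e)\<^sup>2) \<le> (\<Sum>e\<in>E. (r 0 e - s 0 e)\<^sup>2) * exp (- 0 * t)"
  proof (rule gronwall_decay[OF log_flow_sq_dist_derivative[OF assms(2,3)] _ assms(4)])
    show "- 2 * (\<Sum>e\<in>E. (log_curvature E (r u) e - log_curvature E (s u) e) * (r u e - s u e))
        \<le> - 0 * (\<Sum>e\<in>E. (r u e - s u e)\<^sup>2)" for u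
      using log_curvature_monotone[OF assms(1), of "r u" "s u"] by simp
  qed
  then show ?thesis by simp
qed

lemma log_flow_unique:
  assumes "simple_graph V E" "log_flow E \<kappa>' r" "log_flow E \<kappa>' s"
    and "\<And>e. e \<in> E \<Longrightarrow> r 0 e = s 0 e" "0 \<le> t" "e \<in> E"
  shows "r t e = s t e"
proof -
  have fin: "finite E" using simple_graph_finite[OF assms(1)] by simp
  have "(\<Sum>e\<in>E. (r t e - s t e)\<^sup>2) \<le> 0"
    using log_flow_contracts[OF assms(1-3,5)] assms(4) by simp
  moreover have "0 \<le> (\<Sum>e\<in>E. (r t e - s t e)\<^sup>2)" by (simp add: sum_nonneg)
  ultimately have "(\<Sum>e\<in>E. (r t e - s t e)\<^sup>2) = 0" by linarith
  then show ?thesis using assms(6) fin by (simp add: sum_nonneg_eq_0_iff)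
qed

lemma log_flow_sum_conserved:
  assumes "simple_graph V E" "log_flow E \<kappa>' r" "log_flow E \<kappa>' s" "0 \<le> t"
  shows "(\<Sum>e\<in>E. r t e - s t e) = (\<Sum>e\<in>E. r 0 e - s 0 e)"
proof -
  have "((\<lambda>t. \<Sum>e\<in>E. r t e - s t e) has_real_derivative 0) (at u within {0..})" if "0 \<le> u" for u
  proof -
    have "((\<lambda>t. \<Sum>e\<in>E. r t e - s t e) has_real_derivative
        (\<Sum>e\<in>E. (\<kappa>' e - log_curvature E (r u) e) - (\<kappa>' e - log_curvature E (s u) e)))
        (at u within {0..})"
      using assms(2,3) that unfolding log_flow_def
      by (intro DERIV_sum DERIV_diff) auto
    moreover have "(\<Sum>e\<in>E. (\<kappa>' e - log_curvature E (r u) e) - (\<kappa>' e - log_curvature E (s u) e)) = 0"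
      using sum_log_curvature_eq[OF assms(1), of "r u" "s u"] by (simp add: sum_subtractf)
    ultimately show ?thesis by simp
  qed
  then obtain c where "\<And>u. 0 \<le> u \<Longrightarrow> (\<Sum>e\<in>E. r u e - s u e) = c"
    using has_field_derivative_zero_constant[of "{0::real..}" "\<lambda>t. \<Sum>e\<in>E. r t e - s t e"]
    by auto
  then show ?thesis using assms(4) by simp
qed

text \<open>
  The hypothesis on the sum selects, among the translates of \<open>s\<close> by constants, the only one
  to which the solution can converge. By contraction the solution stays within
  distance \<open>R\<close> of \<open>s\<close>, where strong monotonicity holds with a uniform constant; the
  squared distance then decays exponentially.
\<close>

lemma log_flow_exponential_decay:
  assumes "connected_graph V E" "log_flow E \<kappa>' r"
    and "\<And>e. e \<in> E \<Longrightarrow> log_curvature E s e = \<kappa>' e" "(\<Sum>e\<in>E. r 0 e - s e) = 0"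
  obtains R l where "0 \<le> R" "0 < l"
    and "\<And>t e. 0 \<le> t \<Longrightarrow> e \<in> E \<Longrightarrow> \<bar>r t e - s e\<bar> \<le> R * exp (- l * t)"
proof -
  have G: "simple_graph V E" using assms(1) by (simp add: connected_graph_def)
  note fin = simple_graph_finite[OF G]
  have s: "log_flow E \<kappa>' (\<lambda>_. s)" using assms(3) by (simp add: log_flow_def)
  define D where "D t = (\<Sum>e\<in>E. (r t e - s e)\<^sup>2)" for t
  define R where "R = sqrt (D 0)"
  have le_D: "\<bar>r t e - s e\<bar> \<le> sqrt (D t)" if "e \<in> E" for t e
    unfolding D_def using that fin
    by (intro real_le_rsqrt) (auto intro: member_le_sum[where f = "\<lambda>e. (r t e - s e)\<^sup>2"])
  have R: "\<bar>r t e - s e\<bar> \<le> R" if "0 \<le> t" "e \<in> E" for t e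
  proof -
    have "D t \<le> D 0" unfolding D_def using log_flow_contracts[OF G assms(2) s that(1)] .
    then show ?thesis using le_D[OF that(2), of t] by (simp add: R_def order_trans)
  qed
  obtain k where k: "0 < k"
    and mono: "\<And>r. (\<Sum>e\<in>E. r e - s e) = 0 \<Longrightarrow> \<forall>e\<in>E. \<bar>r e - s e\<bar> \<le> R \<Longrightarrow>
           k * (\<Sum>e\<in>E. (r e - s e)\<^sup>2)
           \<le> (\<Sum>e\<in>E. (log_curvature E r e - log_curvature E s e) * (r e - s e))"
    using log_curvature_strongly_monotone[OF assms(1), of s R] by blast
  have decay: "D t \<le> D 0 * exp (- (2 * k) * t)" if "0 \<le> t" for t
    unfolding D_def
  proof (rule gronwall_decay[OF log_flow_sq_dist_derivative[OF assms(2) s] _ that])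
    fix u :: real assume u: "0 \<le> u"
    have "(\<Sum>e\<in>E. r u e - s e) = 0"
      using log_flow_sum_conserved[OF G assms(2) s u] assms(4) by simp
    with mono[of "r u"] R[OF u]
    show "- 2 * (\<Sum>e\<in>E. (log_curvature E (r u) e - log_curvature E s e) * (r u e - s e))
        \<le> - (2 * k) * (\<Sum>e\<in>E. (r u e - s e)\<^sup>2)"
      by simp
  qed
  show thesis
  proof (rule that[of R k])
    show "0 \<le> R" by (simp add: R_def D_def sum_nonneg)
    show "0 < k" by (rule k)
    fix t :: real and e assume t: "0 \<le> t" and e: "e \<in> E"
    have "sqrt (D t) \<le> sqrt (D 0 * exp (- (2 * k) * t))" using decay[OF t] by simp
    also have "exp (- (2 * k) * t) = (exp (- k * t))\<^sup>2" by (simp flip: exp_double)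
    also have "sqrt (D 0 * (exp (- k * t))\<^sup>2) = R * exp (- k * t)"
      by (simp add: R_def real_sqrt_mult)
    finally show "\<bar>r t e - s e\<bar> \<le> R * exp (- k * t)" using le_D[OF e, of t] by linarith
  qed
qed

lemma converges_exponentiallyI:
  assumes "finite I" "0 \<le> A" "0 < l"
    and "\<And>t i. 0 \<le> t \<Longrightarrow> i \<in> I \<Longrightarrow> \<bar>u t i - u' i\<bar> \<le> A * exp (- l * t)"
  shows "converges_exponentially I u u'"
  unfolding converges_exponentially_def
proof (intro exI conjI allI impI)
  show "0 < 1 + card I * A" using assms(2) by (simp add: add_pos_nonneg)
  show "0 < l" by (rule assms(3))
  fix t :: real assume t: "0 \<le> t"
  have "L2_set (\<lambda>i. u t i - u' i) I \<le> (\<Sum>i\<in>I. \<bar>u t i - u' i\<bar>)" by (rule L2_set_le_sum_abs)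
  also have "\<dots> \<le> (\<Sum>i\<in>I. A * exp (- l * t))" using assms(4) t by (intro sum_mono)
  also have "\<dots> \<le> (1 + card I * A) * exp (- l * t)" by (simp add: distrib_right)
  finally show "L2_set (\<lambda>i. u t i - u' i) I \<le> (1 + card I * A) * exp (- l * t)" .
qed

lemma abs_exp_diff_le:
  fixes a b R :: real
  assumes "\<bar>a - b\<bar> \<le> R"
  shows "\<bar>exp a - exp b\<bar> \<le> exp b * exp R * \<bar>a - b\<bar>"
proof -
  define z where "z = a - b"
  have a: "a = b + z" by (simp add: z_def)
  have "exp z * (1 - z) \<le> exp z * exp (- z)"
    using exp_ge_add_one_self[of "- z"] by (intro mult_left_mono) auto
  then have up: "exp z - 1 \<le> exp z * z" by (simp add: algebra_simps flip: exp_add)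
  have "\<bar>exp z - 1\<bar> \<le> exp R * \<bar>z\<bar>"
  proof (cases "0 \<le> z")
    case True
    have "exp z * z \<le> exp R * z" using True assms by (intro mult_right_mono) (auto simp: z_def)
    then show ?thesis using up True by simp
  next
    case False
    have "1 \<le> exp R" using assms by simp
    then have "\<bar>z\<bar> \<le> exp R * \<bar>z\<bar>" using mult_right_mono[of 1 "exp R" "\<bar>z\<bar>"] by simp
    moreover have "\<bar>exp z - 1\<bar> = 1 - exp z" "\<bar>z\<bar> = - z" using False by auto
    ultimately show ?thesis using exp_ge_add_one_self[of z] by linarith
  qed
  then have "exp b * \<bar>exp z - 1\<bar> \<le> exp b * (exp R * \<bar>z\<bar>)" by (intro mult_left_mono) auto
  moreover have "\<bar>exp a - exp b\<bar> = exp b * \<bar>exp z - 1\<bar>"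
  proof -
    have "exp a - exp b = exp b * (exp z - 1)" by (simp add: a exp_add algebra_simps)
    then show ?thesis by (simp add: abs_mult)
  qed
  ultimately show ?thesis by (simp add: z_def mult_ac)
qed

theorem theorem3p2:
  fixes V :: "'a set" and E :: "'a set set"
    and \<kappa>' \<omega>' \<omega>\<^sub>0 :: "'a set \<Rightarrow> real"
  assumes "connected_graph V E"
    and "6 \<le> girth V E"
    and "positive_weight E \<omega>'"
    and "\<forall>e\<in>E. lly_curvature V E \<omega>' e = \<kappa>' e"
    and "positive_weight E \<omega>\<^sub>0"
  shows "\<exists>\<omega>. ricci_flow V E \<kappa>' \<omega>\<^sub>0 \<omega> \<and>
           (\<forall>\<eta>. ricci_flow V E \<kappa>' \<omega>\<^sub>0 \<eta> \<longrightarrow> (\<forall>t\<ge>0. \<forall>e\<in>E. \<eta> t e = \<omega> t e)) \<and>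
           (\<exists>c>0. converges_exponentially E \<omega> (\<lambda>e. c * \<omega>' e)) \<and>
           converges_exponentially E (\<lambda>t. lly_curvature V E (\<omega> t)) \<kappa>'"
proof -
  have G: "simple_graph V E" using assms(1) by (simp add: connected_graph_def)
  note fin = simple_graph_finite(2)[OF G]
  obtain r where r: "log_flow E \<kappa>' r" and r0: "\<And>e. e \<in> E \<Longrightarrow> r 0 e = ln (\<omega>\<^sub>0 e)"
    using log_flow_exists[OF G, of \<kappa>' "\<lambda>e. ln (\<omega>\<^sub>0 e)"] by blast
  \<comment> \<open>The limit \<open>s\<close> is the translate of \<open>ln \<omega>'\<close> with the conserved sum of the initial value, so
    \<open>exp a\<close> is the constant in the limit. Without edges \<open>a\<close> is \<open>0\<close> by division by zero.\<close>
  define a where "a = (\<Sum>e\<in>E. r 0 e - ln (\<omega>' e)) / card E"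
  define s where "s e = ln (\<omega>' e) + a" for e
  have exp_s: "exp (s e) = exp a * \<omega>' e" if "e \<in> E" for e
    using that assms(3) by (simp add: s_def exp_add positive_weight_def)
  have s_eq: "s = (\<lambda>e. ln (\<omega>' e) + a)" by (simp add: s_def fun_eq_iff)
  have curv_s: "log_curvature E s e = \<kappa>' e" if "e \<in> E" for e
    using that assms(4) lly_curvature_ln[OF assms(1-3) that] by (simp add: s_eq log_curvature_add_const)
  have "(\<Sum>e\<in>E. r 0 e - s e) = (\<Sum>e\<in>E. r 0 e - ln (\<omega>' e)) - card E * a"
    by (simp add: s_def sum_subtractf sum.distrib)
  also have "\<dots> = 0" using fin by (cases "E = {}") (simp_all add: a_def)
  finally obtain R l where R: "0 \<le> R" and l: "0 < l"
    and decay: "\<And>t e. 0 \<le> t \<Longrightarrow> e \<in> E \<Longrightarrow> \<bar>r t e - s e\<bar> \<le> R * exp (- l * t)"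
    using log_flow_exponential_decay[OF assms(1) r curv_s] by blast
  let ?\<omega> = "\<lambda>t e. exp (r t e)"
  have flow: "ricci_flow V E \<kappa>' \<omega>\<^sub>0 ?\<omega>"
    using assms(5) r0 by (intro ricci_flow_exp_log_flow[OF assms(1,2) r]) (simp add: positive_weight_def)
  have unique: "\<eta> t e = ?\<omega> t e" if \<eta>: "ricci_flow V E \<kappa>' \<omega>\<^sub>0 \<eta>" and "0 \<le> t" "e \<in> E" for \<eta> t e
  proof -
    have "ln (\<eta> t e) = r t e"
    proof (rule log_flow_unique[OF G log_flow_ln_ricci_flow[OF assms(1,2) \<eta>] r _ that(2,3)])
      show "ln (\<eta> 0 f) = r 0 f" if "f \<in> E" for f
        using \<eta> that r0 by (simp add: ricci_flow_def)
    qed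
    moreover have "0 < \<eta> t e" using \<eta> that by (simp add: ricci_flow_def positive_weight_def)
    ultimately show ?thesis by (metis exp_ln)
  qed
  have "converges_exponentially E ?\<omega> (\<lambda>e. exp a * \<omega>' e)"
  proof (rule converges_exponentiallyI[OF fin _ l])
    let ?B = "(\<Sum>e\<in>E. exp (s e)) * exp R * R"
    show "0 \<le> ?B" using R by (simp add: sum_nonneg)
    fix t :: real and e assume t: "0 \<le> t" and e: "e \<in> E"
    have "R * exp (- l * t) \<le> R * 1" using R l t by (intro mult_left_mono) auto
    then have "\<bar>r t e - s e\<bar> \<le> R" using decay[OF t e] by linarith
    then have "\<bar>exp (r t e) - exp (s e)\<bar> \<le> exp (s e) * exp R * \<bar>r t e - s e\<bar>"
      by (rule abs_exp_diff_le)
    also have "\<dots> \<le> (\<Sum>e\<in>E. exp (s e)) * exp R * (R * exp (- l * t))"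
      using decay[OF t e] e fin R
      by (intro mult_mono) (auto intro!: member_le_sum sum_nonneg mult_nonneg_nonneg)
    finally show "\<bar>exp (r t e) - exp a * \<omega>' e\<bar> \<le> ?B * exp (- l * t)"
      using exp_s[OF e] by (simp add: mult.assoc)
  qed
  then have conv: "\<exists>c>0. converges_exponentially E ?\<omega> (\<lambda>e. c * \<omega>' e)"
    by (intro exI[of _ "exp a"]) simp
  have "converges_exponentially E (\<lambda>t. lly_curvature V E (?\<omega> t)) \<kappa>'"
  proof (rule converges_exponentiallyI[OF fin _ l])
    show "0 \<le> 8 * R" using R by simp
    fix t :: real and e assume t: "0 \<le> t" and e: "e \<in> E"
    show "\<bar>lly_curvature V E (?\<omega> t) e - \<kappa>' e\<bar> \<le> 8 * R * exp (- l * t)"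
      using log_curvature_lipschitz[OF G _ e, of "r t" s, OF decay[OF t]] curv_s[OF e]
        lly_curvature_exp[OF assms(1,2) e]
      by simp
  qed
  with flow unique conv show ?thesis by blast
qed

end
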